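(* Let $b\ge1$ be an integer and $0\le\alpha<1$. Let $P$ be a (possibly random) non-negative integer-valued property of a hash table whose distribution is determined by the profile $(H_i)_{i\in\mathbb Z}$ of the table. Suppose further that almost surely the profile $(H_{\alpha;i})_{i\in\mathbb Z}$ of the infinite Poisson model is such that there exists some $N$ for which the distribution of $P$ is the same for every hash table whose profile equals $H_{\alpha;i}$ for all $|i|\le N$. Let $P_{m,n}$ be the random variable given by $P$ in the exact model with $m$ buckets and $n$ keys, and $P_\alpha$ the random variable given by $P$ in the infinite Poisson model with parameter $\alpha$; let $p_{m,n}(q)$ and $p_\alpha(q)$ be their probability generating functions. Then: (i) If $m,n\to\infty$ with $n/(bm)\to\alpha$, then $P_{m,n}\to P_\alpha$ in distribution, and hence $p_{m,n}(q)\to p_\alpha(q)$ for every $|q|\le1$. (ii) If $m\to\infty$ and $|q|\le1$, then $\mathbf P_m[p_{m,n}(q);b\alpha]\to p_\alpha(q)$, where $\mathbf P_m[p_{m,n}(q);b\alpha]:=e^{-bm\alpha}\sum_{n\ge0}\frac{(bm\alpha)^n}{n!}p_{m,n}(q)$. (iii) If $|q|\le 1$ and the function $G(y):=\sum_{m\ge1}y^m\,\mathbf P_m[p_{m,n}(q);b\alpha]$ has a simple pole at $y=1$ but is otherwise analytic in a disc $|y|<r$ with some $r>1$, then the residue of $G$ at $y=1$ equals $-p_\alpha(q)$.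
   Context: Hash tables: buckets each of capacity $b$; keys are inserted by linear probing (each key goes to the first non-full bucket among its hash address and the following ones). If $X_i$ denotes the number of keys with hash address $i$, the profile is $H_i=b+\max_{j<i}\sum_{k=j+1}^{i}(X_k-b)$ (empty sums are $0$); $H_i$ is the number of keys that try bucket $i$. Exact model: $m$ buckets indexed by $\mathbb Z_m$ (cyclic), $n$ keys with independent uniformly random hash addresses (all $m^n$ tables equally likely); $X_i$ is extended $m$-periodically to $i\in\mathbb Z$ and the profile is given by the formula above (well defined when $n<bm$). For $n$ where the table is not defined (e.g. $n>bm$), $p_{m,n}(q)$ is given by some fixed convention as a probability generating function. Infinite Poisson model with parameter $\alpha\in[0,1)$: buckets indexed by $i\in\mathbb Z$, $X_i=X_{\alpha;i}$ i.i.d. Poisson with mean $\alpha b$; the profile $H_{\alpha;i}$ is given by the formula above (almost surely finite). *)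

theory Defs
  imports "HOL-Probability.Probability" "HOL-Complex_Analysis.Complex_Analysis"
begin

section \<open>Hash tables and their profiles\<close>

text \<open>
  \<open>Cyclic m hs\<close> is a table with \<open>m\<close> buckets, indexed by the residues \<open>0, ..., m - 1\<close>, in which
  the \<open>k\<close>-th key has hash address \<open>hs ! k\<close>. \<open>Infinite X\<close> is a table with buckets indexed by all
  integers in which \<open>X i\<close> keys have hash address \<open>i\<close>.
\<close>
datatype hash_table = Cyclic nat "nat list" | Infinite "int \<Rightarrow> nat"

text \<open>The number \<open>X\<^sub>i\<close> of keys with hash address \<open>i\<close>, extended periodically in the cyclic case.\<close>
fun load :: "hash_table \<Rightarrow> int \<Rightarrow> nat" where
  "load (Cyclic m hs) i = count_list hs (nat (i mod int m))"
| "load (Infinite X) i = X i"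

definition excess :: "nat \<Rightarrow> hash_table \<Rightarrow> int \<Rightarrow> int \<Rightarrow> int" where
  "excess b T i j = (\<Sum>k\<in>{j<..i}. int (load T k) - int b)"

text \<open>
  The index set \<open>j < i\<close> is infinite, so the maximum is written as a supremum. On the integers the
  supremum of a nonempty set that is bounded above is attained; \<open>valid_table\<close> below ensures
  boundedness.
\<close>
definition profile :: "nat \<Rightarrow> hash_table \<Rightarrow> int \<Rightarrow> int" where
  "profile b T i = int b + (SUP j\<in>{..<i}. excess b T i j)"

text \<open>The tables for which the profile is defined (for buckets of capacity \<open>b\<close>).\<close>
fun valid_table :: "nat \<Rightarrow> hash_table \<Rightarrow> bool" where
  "valid_table b (Cyclic m hs) \<longleftrightarrow> m \<ge> 1 \<and> set hs \<subseteq> {..<m} \<and> length hs < b * m"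
| "valid_table b (Infinite X) \<longleftrightarrow> (\<forall>i. bdd_above (excess b (Infinite X) i ` {..<i}))"


section \<open>Properties of hash tables\<close>

text \<open>
  A possibly random property with values in the non-negative integers is given by its
  distribution on each table.
\<close>
type_synonym table_property = "hash_table \<Rightarrow> nat pmf"

definition determined_by_profile :: "nat \<Rightarrow> table_property \<Rightarrow> bool" where
  "determined_by_profile b P \<longleftrightarrow>
     (\<forall>T T'. valid_table b T \<longrightarrow> valid_table b T' \<longrightarrow> profile b T = profile b T' \<longrightarrow> P T = P T')"

text \<open>
  The distribution of the property is the same for every table whose profile coincides with
  \<open>H\<close> in the window from \<open>-N\<close> to \<open>N\<close>.
\<close>
definition determined_by_window :: "nat \<Rightarrow> table_property \<Rightarrow> (int \<Rightarrow> int) \<Rightarrow> nat \<Rightarrow> bool" where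
  "determined_by_window b P H N \<longleftrightarrow>
     (\<exists>D. \<forall>T. valid_table b T \<longrightarrow> (\<forall>i. \<bar>i\<bar> \<le> int N \<longrightarrow> profile b T i = H i) \<longrightarrow> P T = D)"


section \<open>The exact model\<close>

definition cyclic_tables :: "nat \<Rightarrow> nat \<Rightarrow> hash_table set" where
  "cyclic_tables m n = {Cyclic m hs | hs. set hs \<subseteq> {..<m} \<and> length hs = n}"

text \<open>
  The law of \<open>P\<^sub>m\<^sub>,\<^sub>n\<close>; the parameter \<open>conv\<close> is the convention used where the table is not defined.
\<close>
definition exact_law ::
    "nat \<Rightarrow> (nat \<Rightarrow> nat \<Rightarrow> nat pmf) \<Rightarrow> table_property \<Rightarrow> nat \<Rightarrow> nat \<Rightarrow> nat measure" where
  "exact_law b conv P m n = measure_pmf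
     (if n < b * m then bind_pmf (pmf_of_set (cyclic_tables m n)) P else conv m n)"


section \<open>The infinite Poisson model\<close>

text \<open>The library's \<open>poisson_pmf\<close> requires a positive rate, but \<open>\<alpha> = 0\<close> is allowed here.\<close>
definition poisson_law :: "real \<Rightarrow> nat pmf" where
  "poisson_law \<mu> = (if \<mu> = 0 then return_pmf 0 else poisson_pmf \<mu>)"

lemma pmf_poisson_law: "0 \<le> \<mu> \<Longrightarrow> pmf (poisson_law \<mu>) k = \<mu> ^ k / fact k * exp (- \<mu>)"
  by (auto simp: poisson_law_def power_0_left)

definition poisson_model :: "nat \<Rightarrow> real \<Rightarrow> (int \<Rightarrow> nat) measure" where
  "poisson_model b \<alpha> = (\<Pi>\<^sub>M i\<in>UNIV. measure_pmf (poisson_law (\<alpha> * real b)))"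

text \<open>
  The law of \<open>P\<^sub>\<alpha>\<close>. A property that depends, almost surely, only on a finite window of the
  profile is measurable up to a null set; hence the completion, which makes a separate
  measurability assumption on the property unnecessary.
\<close>
definition poisson_model_law :: "nat \<Rightarrow> table_property \<Rightarrow> real \<Rightarrow> nat measure" where
  "poisson_model_law b P \<alpha> =
     Giry_Monad.bind (completion (poisson_model b \<alpha>)) (\<lambda>X. measure_pmf (P (Infinite X)))"


section \<open>Convergence in distribution, generating functions, Poisson transform\<close>

definition converges_in_distribution :: "(nat \<Rightarrow> nat measure) \<Rightarrow> nat measure \<Rightarrow> bool" where
  "converges_in_distribution \<mu> \<nu> \<longleftrightarrow>
     weak_conv_m (\<lambda>k. distr (\<mu> k) borel real) (distr \<nu> borel real)"

definition pgf :: "nat measure \<Rightarrow> complex \<Rightarrow> complex" where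
  "pgf \<mu> q = (LINT k|\<mu>. q ^ k)"

definition poisson_transform :: "nat \<Rightarrow> (nat \<Rightarrow> complex) \<Rightarrow> real \<Rightarrow> complex" where
  "poisson_transform m f x =
     of_real (exp (- (real m * x))) * (\<Sum>n. of_real ((real m * x) ^ n / fact n) * f n)"

end

theory Submission
  imports Defs "HOL-Real_Asymp.Real_Asymp"
begin

text \<open>
  The joint law of the loads of a fixed finite window of buckets in the exact model is multinomial
  and converges pointwise to a product of Poisson laws. A Chernoff bound, uniform in \<open>m\<close> and \<open>n\<close> as
  long as \<open>n \<le> (1 + \<alpha>) / 2 * b * m\<close>, shows that with high probability the maximum defining \<open>H\<^sub>i\<close> is
  attained within distance \<open>L\<close> of \<open>i\<close>; the same bound passes to the Poisson model in the limit. So, up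
  to a small probability, the profile on \<open>[-N, N]\<close>, and hence the law of \<open>P\<close>, is a function of finitely
  many loads, and the convergence of their laws gives (i) through Scheffe's lemma.

  For (ii), (i) says that \<open>p\<^sub>m\<^sub>,\<^sub>n(q)\<close> is close to the limit whenever \<open>m\<close> is large and \<open>n / (b m)\<close> is close
  to \<open>\<alpha>\<close>, and the Poisson weights concentrate there by Chebyshev's inequality. For (iii), by Abel's
  theorem \<open>(1 - y) G(y)\<close> tends to the limit of the coefficients as \<open>y\<close> increases to \<open>1\<close>.
\<close>

section \<open>Limits of probability mass functions and multinomial counts\<close>

text \<open>The window hypothesis concerns profiles that occur almost surely in the Poisson model;
  the obstacle is to show that a cyclic table carries such a profile with high probability. The
  bridge is a canonical representative: a finite list of loads becomes an infinite table with no
  other keys, and the list is \<open>decisive\<close> if the profile of that table on the central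
  window fixes the law of \<open>P\<close>. This is a condition on finitely many loads, so its
  probability in the exact model converges to the Poisson one, which is close to 1. If moreover all
  relevant maxima are attained nearby, a table and its representative share the profile on the
  central window, hence the law of \<open>P\<close>. The sizes \<open>N\<close> and \<open>L\<close>
  must be fixed before m grows, which is why the tail bound has to be uniform. The constant (1 +
  \<alpha>) / 2 serves as a number strictly between \<alpha> and 1: it leaves room above n / (b m)
  and keeps the Chernoff exponent negative.\<close>

lemma expectation_pmf_tendsto:
  fixes f :: "'a \<Rightarrow> 'b::{banach,second_countable_topology}"
  assumes lim: "\<And>x. (\<lambda>k. pmf (p k) x) \<longlonglongrightarrow> pmf p0 x" and bdd: "\<And>x. norm (f x) \<le> B"
  shows "(\<lambda>k. LINT x|measure_pmf (p k). f x) \<longlonglongrightarrow> (LINT x|measure_pmf p0. f x)"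
proof -
  let ?C = "count_space (UNIV :: 'a set)"
  have eq: "(LINT x|measure_pmf r. f x) = (LINT x|?C. pmf r x *\<^sub>R f x)" for r
    unfolding measure_pmf_eq_density by (subst integral_density) auto
  have int: "integrable ?C (\<lambda>x. pmf r x *\<^sub>R f x)" for r
  proof (rule Bochner_Integration.integrable_bound[of _ "\<lambda>x. pmf r x * B"])
    show "integrable ?C (\<lambda>x. pmf r x * B)"
      using integrable_pmf by (intro integrable_mult_left)
    show "AE x in ?C. norm (pmf r x *\<^sub>R f x) \<le> norm (pmf r x * B)"
    proof (intro AE_I2)
      fix x
      have "norm (pmf r x *\<^sub>R f x) = pmf r x * norm (f x)" by simp
      also have "\<dots> \<le> pmf r x * B" by (intro mult_left_mono bdd pmf_nonneg)
      also have "\<dots> \<le> norm (pmf r x * B)" by simp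
      finally show "norm (pmf r x *\<^sub>R f x) \<le> norm (pmf r x * B)" .
    qed
  qed auto
  \<comment> \<open>Both sides have total mass 1, so Scheffe's lemma upgrades pointwise convergence
    of the masses to convergence in L1; any bounded \<open>f\<close> can then be integrated.\<close>
  have "(\<lambda>k. \<integral>\<^sup>+ x. norm (pmf (p k) x - pmf p0 x) \<partial>?C) \<longlonglongrightarrow> 0"
    by (rule Scheffe_lemma2) (auto simp: integrable_pmf lim nn_integral_pmf measure_pmf.emeasure_eq_measure)
  moreover have "(\<integral>\<^sup>+ x. norm (pmf (p k) x - pmf p0 x) \<partial>?C)
      = ennreal (LINT x|?C. \<bar>pmf (p k) x - pmf p0 x\<bar>)" for k
    by (subst nn_integral_eq_integral)
       (auto intro!: integrable_abs Bochner_Integration.integrable_diff integrable_pmf)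
  ultimately have "(\<lambda>k. ennreal (LINT x|?C. \<bar>pmf (p k) x - pmf p0 x\<bar>)) \<longlonglongrightarrow> ennreal 0"
    by simp
  then have L1: "(\<lambda>k. LINT x|?C. \<bar>pmf (p k) x - pmf p0 x\<bar>) \<longlonglongrightarrow> 0"
    by (subst (asm) tendsto_ennreal_iff) auto
  have "norm ((LINT x|measure_pmf (p k). f x) - (LINT x|measure_pmf p0. f x))
      \<le> (LINT x|?C. \<bar>pmf (p k) x - pmf p0 x\<bar>) * B" for k
  proof -
    have "(LINT x|measure_pmf (p k). f x) - (LINT x|measure_pmf p0. f x)
        = (LINT x|?C. (pmf (p k) x - pmf p0 x) *\<^sub>R f x)"
      unfolding eq using int by (subst Bochner_Integration.integral_diff[symmetric])
        (auto simp: scaleR_diff_left)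
    also have "norm \<dots> \<le> (LINT x|?C. \<bar>pmf (p k) x - pmf p0 x\<bar> * B)"
    proof (rule order_trans[OF integral_norm_bound], rule integral_mono)
      show "integrable ?C (\<lambda>x. norm ((pmf (p k) x - pmf p0 x) *\<^sub>R f x))"
        using int by (auto intro!: Bochner_Integration.integrable_diff integrable_norm simp: scaleR_diff_left)
      show "integrable ?C (\<lambda>x. \<bar>pmf (p k) x - pmf p0 x\<bar> * B)"
        by (intro integrable_mult_left integrable_abs Bochner_Integration.integrable_diff integrable_pmf)
    qed (auto intro!: mult_left_mono bdd)
    finally show ?thesis by simp
  qed
  then have "(\<lambda>k. (LINT x|measure_pmf (p k). f x) - (LINT x|measure_pmf p0. f x)) \<longlonglongrightarrow> 0"
    by (intro Lim_null_comparison[OF _ tendsto_mult_left_zero[OF L1, of B]]) auto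
  then show ?thesis by (simp add: LIM_zero_iff)
qed

lemma measure_pmf_tendsto:
  assumes "\<And>x. (\<lambda>k. pmf (p k) x) \<longlonglongrightarrow> pmf p0 x"
  shows "(\<lambda>k. measure (measure_pmf (p k)) A) \<longlonglongrightarrow> measure (measure_pmf p0) A"
  using expectation_pmf_tendsto[OF assms, where f = "indicator A :: _ \<Rightarrow> real" and B = 1]
  by simp

section \<open>Counting words with prescribed letter counts, and the Poisson limit of the
  count\<close>

text \<open>With s the sum of the \<open>x i\<close>: choose the s positions of tracked letters,
  arrange these letters in s! divided by the product of the \<open>fact (x i)\<close> ways, and fill
  the other positions freely with the \<open>card A - L\<close> untracked letters. The factorials
  are multiplied out to stay in the naturals. For s > n both sides are 0.\<close>

lemma card_lists_with_counts:
  assumes A: "finite A" and inj: "inj_on c {..<L::nat}" and sub: "c ` {..<L} \<subseteq> A"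
  shows "card {hs. set hs \<subseteq> A \<and> length hs = n \<and> (\<forall>i<L. count_list hs (c i) = x i)} * (\<Prod>i<L. fact (x i))
    = (n choose (\<Sum>i<L. x i)) * fact (\<Sum>i<L. x i) * (card A - L) ^ (n - (\<Sum>i<L. x i))"
proof (induction n arbitrary: x)
  case 0
  show ?case
  proof (cases "\<forall>i<L. x i = 0")
    case True
    then have "{hs. set hs \<subseteq> A \<and> length hs = 0 \<and> (\<forall>i<L. count_list hs (c i) = x i)} = {[]}"
      by auto
    then show ?thesis using True by simp
  next
    case False
    then have "{hs. set hs \<subseteq> A \<and> length hs = 0 \<and> (\<forall>i<L. count_list hs (c i) = x i)} = {}"
      by auto
    moreover have "(\<Sum>i<L. x i) \<noteq> 0"
    proof -
      obtain i where "i < L" "x i \<noteq> 0" using False by blast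
      then show ?thesis using member_le_sum[of i "{..<L}" x] by (metis finite_lessThan le_zero_eq lessThan_iff zero_le)
    qed
    then have "0 choose (\<Sum>i<L. x i) = 0" by (simp only: binomial_eq_0 neq0_conv)
    ultimately show ?thesis by (simp only: card.empty mult_zero_left)
  qed
next
  case (Suc n)
  let ?S = "\<lambda>n x. {hs. set hs \<subseteq> A \<and> length hs = n \<and> (\<forall>i<L. count_list hs (c i) = x i)}"
  let ?s = "\<lambda>x. \<Sum>i<L. x i :: nat"
  define r where "r = card A - L"
  have cc: "card (c ` {..<L}) = L" using inj by (simp add: card_image)
  define T where "T h = {hs \<in> {hs. set hs \<subseteq> A \<and> length hs = n}. \<forall>i<L. count_list (h # hs) (c i) = x i}" for h
  have fT: "finite (T h)" for h
    unfolding T_def by (rule finite_subset[OF _ finite_lists_length_eq[OF A, of n]]) auto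
  \<comment> \<open>Split by the head of the word: an untracked head keeps all required counts,
    while the head \<open>c j\<close> uses up one occurrence and lowers \<open>x j\<close> by
    one.\<close>
  have Sun: "?S (Suc n) x = (\<Union>h\<in>A. (#) h ` T h)"
  proof -
    define Q where "Q hs \<longleftrightarrow> (\<forall>i<L. count_list hs (c i) = x i)" for hs
    have "{hs. set hs \<subseteq> A \<and> length hs = Suc n \<and> Q hs}
        = (\<Union>h\<in>A. (#) h ` {hs \<in> {hs. set hs \<subseteq> A \<and> length hs = n}. Q (h # hs)})"
      by (auto simp: length_Suc_conv image_iff)
    then show ?thesis unfolding Q_def T_def .
  qed
  have "card (?S (Suc n) x) = (\<Sum>h\<in>A. card ((#) h ` T h))"
    unfolding Sun by (rule card_UN_disjoint) (use A fT in auto)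
  also have "\<dots> = (\<Sum>h\<in>A. card (T h))"
    by (intro sum.cong card_image) auto
  also have "\<dots> = (\<Sum>h\<in>A - c ` {..<L}. card (T h)) + (\<Sum>h\<in>c ` {..<L}. card (T h))"
    using A sub by (simp add: sum.subset_diff)
  also have "(\<Sum>h\<in>A - c ` {..<L}. card (T h)) = (\<Sum>h\<in>A - c ` {..<L}. card (?S n x))"
  proof (rule sum.cong)
    fix h assume "h \<in> A - c ` {..<L}"
    then have "T h = ?S n x" unfolding T_def by auto
    then show "card (T h) = card (?S n x)" by simp
  qed simp
  also have "\<dots> = r * card (?S n x)"
    using A sub cc by (simp add: card_Diff_subset finite_subset r_def)
  also have "(\<Sum>h\<in>c ` {..<L}. card (T h)) = (\<Sum>j<L. card (T (c j)))"
    using inj by (simp add: sum.reindex)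
  finally have rec: "card (?S (Suc n) x) = r * card (?S n x) + (\<Sum>j<L. card (T (c j)))" .
  \<comment> \<open>Lowering \<open>x j\<close> divides the product of factorials by
    \<open>x j\<close>, whence the factor \<open>x j\<close>. This factor also makes the truncated
    subtraction harmless: for \<open>x j = 0\<close> both sides vanish.\<close>
  have Tj: "card (T (c j)) * (\<Prod>i<L. fact (x i)) =
       x j * ((n choose (?s x - 1)) * fact (?s x - 1) * r ^ (n - (?s x - 1)))" if j: "j < L" for j
  proof (cases "x j")
    case 0
    then have "T (c j) = {}" unfolding T_def using j by auto
    with 0 show ?thesis by simp
  next
    case (Suc y)
    define x' where "x' = x(j := y)"
    have ceq: "c j = c i \<longleftrightarrow> i = j" if "i < L" for i
      using inj j that by (auto simp: inj_on_def)
    have "T (c j) = ?S n x'"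
      unfolding T_def x'_def using Suc j by (auto simp: ceq)
    moreover have "(\<Prod>i<L. fact (x i)) = x j * (\<Prod>i<L. fact (x' i) :: nat)"
      using j Suc by (simp add: prod.remove[of _ j] x'_def algebra_simps)
    moreover have "?s x = Suc (?s x')"
      using j Suc by (simp add: sum.remove[of _ j] x'_def)
    ultimately show ?thesis using Suc.IH[of x'] by (simp add: r_def)
  qed
  have "card (?S (Suc n) x) * (\<Prod>i<L. fact (x i)) =
     r * ((n choose ?s x) * fact (?s x) * r ^ (n - ?s x)) +
     (\<Sum>j<L. x j * ((n choose (?s x - 1)) * fact (?s x - 1) * r ^ (n - (?s x - 1))))"
    unfolding rec add_mult_distrib sum_distrib_right
    by (intro arg_cong2[where f = "(+)"] sum.cong) (simp_all add: Tj mult.assoc Suc.IH flip: r_def)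
  also have "\<dots> = r * ((n choose ?s x) * fact (?s x) * r ^ (n - ?s x)) +
     ?s x * ((n choose (?s x - 1)) * fact (?s x - 1) * r ^ (n - (?s x - 1)))"
    by (simp add: sum_distrib_right)
  \<comment> \<open>Pascal's rule together with s (s - 1)! = s!. If s exceeds \<open>n\<close>, the
    first summand vanishes through its binomial coefficient, whatever the truncated exponent
    is.\<close>
  also have "\<dots> = (Suc n choose ?s x) * fact (?s x) * r ^ (Suc n - ?s x)"
  proof (cases "?s x")
    case 0
    then show ?thesis by simp
  next
    case (Suc t)
    show ?thesis
    proof (cases "Suc t \<le> n")
      case True
      then have "n - t = Suc (n - Suc t)" by simp
      then show ?thesis unfolding Suc by (simp add: algebra_simps)
    next
      case False
      then show ?thesis unfolding Suc by (simp add: algebra_simps binomial_eq_0)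
    qed
  qed
  finally show ?case by (simp add: r_def)
qed

text \<open>The falling factorial n (n - 1) ... (n - s + 1) over m^s tends to
  \<open>\<mu> ^ s\<close>. What remains is (1 - L/m)^(n - s), and each of the L tracked buckets
  contributes a factor exp(-\<mu>) to its limit. Up to the factorials this is the joint mass of L
  independent Poisson loads.\<close>

lemma multinomial_tendsto_poisson:
  assumes m: "filterlim m at_top sequentially"
    and lim: "(\<lambda>k. real (n k) / real (m k)) \<longlonglongrightarrow> \<mu>"
  shows "(\<lambda>k. real ((n k choose s) * fact s * (m k - L) ^ (n k - s)) / real (m k ^ n k))
    \<longlonglongrightarrow> \<mu> ^ s * exp (- \<mu>) ^ L"
proof -
  have mr: "filterlim (\<lambda>k. real (m k)) at_top sequentially"
    using filterlim_compose[OF filterlim_real_sequentially m] .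
  have inv: "(\<lambda>k. c / real (m k)) \<longlonglongrightarrow> 0" for c :: real
    by (rule tendsto_divide_0[OF tendsto_const filterlim_at_top_imp_at_infinity[OF mr]])
  have q: "(\<lambda>k. 1 - real L / real (m k)) \<longlonglongrightarrow> 1"
    using tendsto_diff[OF tendsto_const inv[of "real L"], of 1] by simp
  have lnlim: "(\<lambda>k. real (m k) * ln (1 - real L / real (m k))) \<longlonglongrightarrow> - real L"
  proof -
    have "((\<lambda>x::real. x * ln (1 - real L / x)) \<longlongrightarrow> - real L) at_top"
      by real_asymp
    from filterlim_compose[OF this mr] show ?thesis .
  qed
  have expl: "(\<lambda>k. exp (real (n k) / real (m k) * (real (m k) * ln (1 - real L / real (m k))))) \<longlonglongrightarrow> exp (\<mu> * (- real L))"
    by (intro tendsto_exp tendsto_mult lim lnlim)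
  have ev: "\<forall>\<^sub>F k in sequentially. m k > L"
    using m eventually_gt_at_top[of L] unfolding filterlim_iff by blast
  have pw: "(\<lambda>k. (1 - real L / real (m k)) ^ n k) \<longlonglongrightarrow> exp (\<mu> * (- real L))"
  proof (rule Lim_transform_eventually[OF expl])
    show "\<forall>\<^sub>F k in sequentially. exp (real (n k) / real (m k) * (real (m k) * ln (1 - real L / real (m k))))
       = (1 - real L / real (m k)) ^ n k"
      using ev
    proof eventually_elim
      case (elim k)
      then have "1 - real L / real (m k) > 0" by simp
      then show ?case using elim by (simp add: exp_of_nat_mult)
    qed
  qed
  have fac: "(\<lambda>k. real (n k) / real (m k) - real i / real (m k)) \<longlonglongrightarrow> \<mu>" for i
    using tendsto_diff[OF lim inv[of "real i"]] by simp
  have main: "(\<lambda>k. (\<Prod>i<s. real (n k) / real (m k) - real i / real (m k))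
     * ((1 - real L / real (m k)) ^ n k / (1 - real L / real (m k)) ^ s))
     \<longlonglongrightarrow> (\<Prod>i<s. \<mu>) * (exp (\<mu> * (- real L)) / 1 ^ s)"
    by (intro tendsto_mult tendsto_prod tendsto_divide tendsto_power fac pw q) auto
  have "(\<Prod>i<s. \<mu>) * (exp (\<mu> * (- real L)) / 1 ^ s) = \<mu> ^ s * exp (- \<mu>) ^ L"
    by (simp add: exp_of_nat_mult[symmetric] mult_ac)
  with main have "(\<lambda>k. (\<Prod>i<s. real (n k) / real (m k) - real i / real (m k))
     * ((1 - real L / real (m k)) ^ n k / (1 - real L / real (m k)) ^ s)) \<longlonglongrightarrow> \<mu> ^ s * exp (- \<mu>) ^ L"
    by (simp only:)
  then show ?thesis
  proof (rule Lim_transform_eventually)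
    show "\<forall>\<^sub>F k in sequentially. (\<Prod>i<s. real (n k) / real (m k) - real i / real (m k))
     * ((1 - real L / real (m k)) ^ n k / (1 - real L / real (m k)) ^ s)
     = real ((n k choose s) * fact s * (m k - L) ^ (n k - s)) / real (m k ^ n k)"
      using ev
    proof eventually_elim
      case (elim k)
      have pr: "(\<Prod>i<s. real (n k) / real (m k) - real i / real (m k))
          = real ((n k choose s) * fact s) / real (m k) ^ s"
      proof -
        have "real ((n k choose s) * fact s) = (\<Prod>i<s. real (n k) - real i)"
          using gbinomial_mult_fact[of s "real (n k)"]
          by (simp add: binomial_gbinomial mult.commute atLeast0LessThan)
        then show ?thesis by (simp add: diff_divide_distrib[symmetric] prod_dividef)
      qed
      show ?case
      proof (cases "s \<le> n k")
        case False
        then show ?thesis unfolding pr by (simp add: binomial_eq_0)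
      next
        case True
        have pos: "1 - real L / real (m k) > 0" using elim by simp
        have "(1 - real L / real (m k)) ^ n k / (1 - real L / real (m k)) ^ s
            = (1 - real L / real (m k)) ^ (n k - s)"
          using True pos power_diff[of "1 - real L / real (m k)" s "n k"] by (metis less_irrefl)
        also have "1 - real L / real (m k) = real (m k - L) / real (m k)"
          using elim by (simp add: field_simps of_nat_diff)
        moreover have "real (m k) ^ n k = real (m k) ^ s * real (m k) ^ (n k - s)"
          using True by (simp flip: power_add)
        ultimately show ?thesis unfolding pr by (simp add: power_divide)
      qed
    qed
  qed
qed

section \<open>The law of finitely many loads\<close>

definition window :: "int \<Rightarrow> nat \<Rightarrow> (int \<Rightarrow> nat) \<Rightarrow> nat list" where
  "window a L X = map (\<lambda>i. X (a + int i)) [0..<L]"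

text \<open>The default 0 means that there are no keys outside the window. Any finite list of loads
  thus becomes an infinite table on which \<open>P\<close> can be evaluated.\<close>

definition extend :: "int \<Rightarrow> nat list \<Rightarrow> int \<Rightarrow> nat" where
  "extend a xs i = (if a \<le> i \<and> i < a + int (length xs) then xs ! nat (i - a) else 0)"

lemma length_window [simp]: "length (window a L X) = L"
  by (simp add: window_def)

lemma extend_window: "extend a (window a L X) i = (if a \<le> i \<and> i < a + int L then X i else 0)"
  by (auto simp: extend_def window_def)

lemma window_eq_iff: "window a L X = xs \<longleftrightarrow> length xs = L \<and> (\<forall>i<L. X (a + int i) = xs ! i)"
  by (auto simp: window_def list_eq_iff_nth_eq)

lemma cyclic_tables_image:
  "cyclic_tables m n = Cyclic m ` {hs. set hs \<subseteq> {..<m} \<and> length hs = n}"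
  by (auto simp: cyclic_tables_def)

lemma card_cyclic_tables: "card (cyclic_tables m n) = m ^ n"
  unfolding cyclic_tables_image by (subst card_image) (auto simp: card_lists_length_eq inj_on_def)

lemma finite_cyclic_tables [simp]: "finite (cyclic_tables m n)"
  unfolding cyclic_tables_image by (intro finite_imageI finite_lists_length_eq) auto

lemma cyclic_tables_nonempty: "m \<ge> 1 \<Longrightarrow> cyclic_tables m n \<noteq> {}"
  using card_cyclic_tables[of m n] by (metis card.empty not_one_le_zero power_not_zero)

abbreviation exact_table :: "nat \<Rightarrow> nat \<Rightarrow> hash_table pmf" where
  "exact_table m n \<equiv> pmf_of_set (cyclic_tables m n)"

text \<open>Since L \<le> m, the buckets of the window are distinct residues, so the count of words
  with prescribed letter counts applies with the m addresses as alphabet.\<close>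

lemma pmf_exact_window:
  assumes "L \<le> m" "m \<ge> 1" "length xs = L"
  defines "s \<equiv> \<Sum>i<L. xs ! i"
  shows "pmf (map_pmf (\<lambda>T. window a L (load T)) (exact_table m n)) xs
    = real ((n choose s) * fact s * (m - L) ^ (n - s)) / real (m ^ n) / (\<Prod>i<L. fact (xs ! i))"
proof -
  define c where "c i = nat ((a + int i) mod int m)" for i
  have cm: "c i < m" for i
    using assms by (simp add: c_def nat_less_iff)
  have inj: "inj_on c {..<L}"
  proof
    fix i j assume ij: "i \<in> {..<L}" "j \<in> {..<L}" "c i = c j"
    then have "(a + int i) mod int m = (a + int j) mod int m"
      using assms by (simp add: c_def nat_eq_iff)
    then have "int m dvd (a + int i) - (a + int j)" by (simp add: mod_eq_dvd_iff)
    then have "int m dvd int i - int j" by simp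
    moreover have "\<bar>int i - int j\<bar> < int m" using ij assms by auto
    ultimately show "i = j" using dvd_imp_le_int[of "int i - int j" "int m"] by auto
  qed
  let ?S = "{hs. set hs \<subseteq> {..<m} \<and> length hs = n \<and> (\<forall>i<L. count_list hs (c i) = xs ! i)}"
  have "pmf (map_pmf (\<lambda>T. window a L (load T)) (exact_table m n)) xs
      = real (card (cyclic_tables m n \<inter> (\<lambda>T. window a L (load T)) -` {xs})) / real (m ^ n)"
    using assms by (simp add: pmf_map measure_pmf_of_set cyclic_tables_nonempty card_cyclic_tables)
  also have "cyclic_tables m n \<inter> (\<lambda>T. window a L (load T)) -` {xs} = Cyclic m ` ?S"
    using assms by (auto simp: cyclic_tables_image window_eq_iff c_def)
  also have "card \<dots> = card ?S" by (subst card_image) (auto simp: inj_on_def)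
  finally have eq: "pmf (map_pmf (\<lambda>T. window a L (load T)) (exact_table m n)) xs = real (card ?S) / real (m ^ n)" .
  have nat_eq: "card ?S * (\<Prod>i<L. fact (xs ! i)) = (n choose s) * fact s * (m - L) ^ (n - s)"
    using card_lists_with_counts[OF _ inj, of "{..<m}" n "(!) xs"] cm by (auto simp: s_def)
  have "real (card ?S) * (\<Prod>i<L. fact (xs ! i)) = real ((n choose s) * fact s * (m - L) ^ (n - s))"
    unfolding nat_eq[symmetric] by (simp add: of_nat_prod)
  moreover have nz: "(\<Prod>i<L. fact (xs ! i)) \<noteq> (0 :: real)" by simp
  ultimately have "real (card ?S) = real ((n choose s) * fact s * (m - L) ^ (n - s)) / (\<Prod>i<L. fact (xs ! i))"
    unfolding nonzero_eq_divide_eq[OF nz] by blast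
  with eq show ?thesis by simp
qed

section \<open>Finite windows of the Poisson model\<close>

lemma prob_space_poisson_model: "prob_space (poisson_model b \<alpha>)"
  unfolding poisson_model_def by (intro prob_space_PiM) (simp add: measure_pmf.prob_space_axioms)

lemma space_poisson_model [simp]: "space (poisson_model b \<alpha>) = UNIV"
  by (simp add: poisson_model_def space_PiM)

lemma window_cylinder:
  fixes a :: int and L :: nat
  assumes "length xs = L"
  shows "{X. window a L X = xs} = prod_emb UNIV (\<lambda>_. measure_pmf p) {a..<a + int L}
    (\<Pi>\<^sub>E i\<in>{a..<a + int L}. {extend a xs i})"
proof -
  have "window a L X = xs \<longleftrightarrow> (\<forall>i\<in>{a..<a + int L}. X i = extend a xs i)" for X
  proof
    assume *: "\<forall>i\<in>{a..<a + int L}. X i = extend a xs i"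
    show "window a L X = xs"
      unfolding window_eq_iff using assms *[rule_format, of "a + int i" for i] by (auto simp: extend_def)
  next
    assume "window a L X = xs"
    then show "\<forall>i\<in>{a..<a + int L}. X i = extend a xs i" by (auto simp: extend_window)
  qed
  then show ?thesis by (auto simp: prod_emb_def PiE_iff)
qed

lemma sets_window_eq: "{X. window a L X = xs} \<in> sets (poisson_model b \<alpha>)"
proof (cases "length xs = L")
  case True
  show ?thesis unfolding window_cylinder[OF True, of a "poisson_law (\<alpha> * real b)"] poisson_model_def
    by (rule sets_PiM_I) auto
next
  case False
  then have "{X. window a L X = xs} = {}" by auto
  then show ?thesis by (simp only: sets.empty_sets)
qed

lemma measurable_window [measurable]: "window a L \<in> poisson_model b \<alpha> \<rightarrow>\<^sub>M count_space UNIV"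
proof -
  have "window a L -` {xs} \<inter> space (poisson_model b \<alpha>) \<in> sets (poisson_model b \<alpha>)" for xs
    using sets_window_eq[of a L xs] by (simp add: vimage_def)
  then show ?thesis by (subst measurable_count_space_eq2_countable) auto
qed

lemma measure_window_eq:
  assumes "length xs = L"
  shows "measure (poisson_model b \<alpha>) {X. window a L X = xs} = (\<Prod>i<L. pmf (poisson_law (\<alpha> * real b)) (xs ! i))"
proof -
  let ?q = "poisson_law (\<alpha> * real b)"
  interpret product_prob_space "\<lambda>_::int. measure_pmf ?q" UNIV
    by (intro product_prob_spaceI) (simp add: measure_pmf.prob_space_axioms)
  have "measure (poisson_model b \<alpha>) {X. window a L X = xs}
      = (\<Prod>i\<in>{a..<a + int L}. pmf ?q (extend a xs i))"
    unfolding window_cylinder[OF assms, of a ?q] poisson_model_def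
    by (subst measure_PiM_emb) (auto simp: pmf.rep_eq)
  also have "{a..<a + int L} = (\<lambda>i. a + int i) ` {..<L}"
    by (auto simp: image_iff intro!: bexI[of _ "nat (x - a)" for x])
  also have "(\<Prod>i\<in>\<dots>. pmf ?q (extend a xs i)) = (\<Prod>i<L. pmf ?q (xs ! i))"
    using assms by (subst prod.reindex) (auto simp: inj_on_def extend_def)
  finally show ?thesis .
qed

text \<open>Packed as a \<open>pmf\<close> so that the limit lemmas for mass functions apply; lists
  of naturals form a countable type, so the image measure is discrete.\<close>

definition window_pmf :: "nat \<Rightarrow> real \<Rightarrow> int \<Rightarrow> nat \<Rightarrow> nat list pmf" where
  "window_pmf b \<alpha> a L = Abs_pmf (distr (poisson_model b \<alpha>) (count_space UNIV) (window a L))"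

lemma measure_pmf_Abs_pmf:
  fixes M :: "'a :: countable measure"
  assumes "prob_space M" "sets M = UNIV"
  shows "measure_pmf (Abs_pmf M) = M"
proof -
  interpret prob_space M by fact
  have "\<exists>S. countable S \<and> (AE x in M. x \<in> S)" by (intro exI[of _ UNIV]) auto
  then show ?thesis using assms AE_support_countable by (intro Abs_pmf_inverse) auto
qed

lemma measure_pmf_window_pmf:
  "measure_pmf (window_pmf b \<alpha> a L) = distr (poisson_model b \<alpha>) (count_space UNIV) (window a L)"
  unfolding window_pmf_def
  by (intro measure_pmf_Abs_pmf prob_space.prob_space_distr prob_space_poisson_model) simp_all

lemma pmf_window_pmf:
  "pmf (window_pmf b \<alpha> a L) xs
    = (if length xs = L then \<Prod>i<L. pmf (poisson_law (\<alpha> * real b)) (xs ! i) else 0)"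
proof -
  have "pmf (window_pmf b \<alpha> a L) xs = measure (poisson_model b \<alpha>) {X. window a L X = xs}"
    unfolding pmf.rep_eq measure_pmf_window_pmf by (subst measure_distr) (auto simp: vimage_def)
  moreover have "{X. window a L X = xs} = {}" if "length xs \<noteq> L" using that by auto
  ultimately show ?thesis using measure_window_eq[of xs L] by auto
qed

section \<open>Convergence of window statistics along a sequence of exact models\<close>

context
  fixes m n :: "nat \<Rightarrow> nat" and \<alpha> :: real and b :: nat
  assumes m: "filterlim m at_top sequentially"
    and lim: "(\<lambda>k. real (n k) / real (m k)) \<longlonglongrightarrow> \<alpha> * real b"
    and \<alpha>: "0 \<le> \<alpha>"
begin

lemma pmf_window_tendsto:
  "(\<lambda>k. pmf (map_pmf (\<lambda>T. window a L (load T)) (exact_table (m k) (n k))) xs)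
    \<longlonglongrightarrow> pmf (window_pmf b \<alpha> a L) xs"
proof -
  have ev: "\<forall>\<^sub>F k in sequentially. max 1 L \<le> m k"
    using m eventually_ge_at_top[of "max 1 L"] unfolding filterlim_iff by blast
  show ?thesis
  proof (cases "length xs = L")
    case False
    have "\<forall>\<^sub>F k in sequentially. pmf (window_pmf b \<alpha> a L) xs
       = pmf (map_pmf (\<lambda>T. window a L (load T)) (exact_table (m k) (n k))) xs"
      using False by (intro always_eventually allI) (auto simp: pmf_window_pmf pmf_eq_0_set_pmf)
    then show ?thesis by (rule Lim_transform_eventually[OF tendsto_const])
  next
    case True
    define s where "s = (\<Sum>i<L. xs ! i)"
    let ?\<mu> = "\<alpha> * real b"
    have lims: "(\<lambda>k. real ((n k choose s) * fact s * (m k - L) ^ (n k - s)) / real (m k ^ n k) / (\<Prod>i<L. fact (xs ! i)))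
       \<longlonglongrightarrow> ?\<mu> ^ s * exp (- ?\<mu>) ^ L / (\<Prod>i<L. fact (xs ! i))"
      by (intro tendsto_divide multinomial_tendsto_poisson m lim tendsto_const) simp
    have "?\<mu> ^ s * exp (- ?\<mu>) ^ L / (\<Prod>i<L. fact (xs ! i))
        = (\<Prod>i<L. ?\<mu> ^ (xs ! i) / fact (xs ! i) * exp (- ?\<mu>))"
      by (simp only: prod.distrib prod_dividef s_def power_sum prod_constant card_lessThan) simp
    also have "\<dots> = pmf (window_pmf b \<alpha> a L) xs"
      using True \<alpha> by (simp add: pmf_window_pmf pmf_poisson_law)
    finally have eq: "?\<mu> ^ s * exp (- ?\<mu>) ^ L / (\<Prod>i<L. fact (xs ! i)) = pmf (window_pmf b \<alpha> a L) xs" .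
    have "\<forall>\<^sub>F k in sequentially. real ((n k choose s) * fact s * (m k - L) ^ (n k - s)) / real (m k ^ n k) / (\<Prod>i<L. fact (xs ! i))
       = pmf (map_pmf (\<lambda>T. window a L (load T)) (exact_table (m k) (n k))) xs"
      using ev by eventually_elim (subst pmf_exact_window, use True in \<open>auto simp: s_def\<close>)
    from Lim_transform_eventually[OF lims this] show ?thesis unfolding eq .
  qed
qed

lemma expectation_window_tendsto:
  fixes f :: "nat list \<Rightarrow> real"
  assumes "\<And>xs. norm (f xs) \<le> B"
  shows "(\<lambda>k. LINT T|measure_pmf (exact_table (m k) (n k)). f (window a L (load T)))
    \<longlonglongrightarrow> (LINT X|poisson_model b \<alpha>. f (window a L X))"
  using expectation_pmf_tendsto[OF pmf_window_tendsto assms, of a L]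
  by (simp add: measure_pmf_window_pmf integral_distr)

lemma prob_window_tendsto:
  "(\<lambda>k. measure (measure_pmf (exact_table (m k) (n k))) {T. Q (window a L (load T))})
    \<longlonglongrightarrow> measure (poisson_model b \<alpha>) {X. Q (window a L X)}"
proof -
  have "measure (measure_pmf (window_pmf b \<alpha> a L)) {xs. Q xs} = measure (poisson_model b \<alpha>) {X. Q (window a L X)}"
    unfolding measure_pmf_window_pmf by (subst measure_distr) (auto simp: vimage_def)
  with measure_pmf_tendsto[OF pmf_window_tendsto, of a L "{xs. Q xs}"] show ?thesis
    by (simp add: vimage_def)
qed

end

section \<open>Locality of the profile\<close>

text \<open>The supremum in the definition of the profile at \<open>i\<close> is attained within distance \<open>L\<close> of \<open>i\<close>.\<close>
definition settled :: "nat \<Rightarrow> hash_table \<Rightarrow> int \<Rightarrow> nat \<Rightarrow> bool" where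
  "settled b T i L \<longleftrightarrow> (\<forall>j<i - int L. \<exists>j'\<in>{i - int L..<i}. excess b T i j \<le> excess b T i j')"

lemma settled_bound:
  assumes "settled b T i L" "L \<ge> 1" "j < i"
  shows "excess b T i j \<le> Max (excess b T i ` {i - int L..<i})"
proof (cases "j < i - int L")
  case True
  then obtain j' where "j' \<in> {i - int L..<i}" "excess b T i j \<le> excess b T i j'"
    using assms unfolding settled_def by blast
  then show ?thesis by (intro order_trans[OF _ Max_ge]) auto
next
  case False
  then show ?thesis using assms by (intro Max_ge) auto
qed

lemma settled_bdd_above:
  assumes "settled b T i L" "L \<ge> 1"
  shows "bdd_above (excess b T i ` {..<i})"
  using settled_bound[OF assms] by (intro bdd_aboveI2[where M = "Max (excess b T i ` {i - int L..<i})"]) auto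

lemma settled_profile:
  assumes "settled b T i L" "L \<ge> 1"
  shows "profile b T i = int b + Max (excess b T i ` {i - int L..<i})"
proof -
  have "Max (excess b T i ` {i - int L..<i}) \<in> excess b T i ` {i - int L..<i}"
    using assms by (intro Max_in) auto
  then have "(SUP j\<in>{..<i}. excess b T i j) = Max (excess b T i ` {i - int L..<i})"
    using settled_bound[OF assms] by (intro cSup_eq_maximum) auto
  then show ?thesis by (simp add: profile_def)
qed

text \<open>The sum starts at \<open>j + 1\<close>, not at \<open>j\<close>, so a window that begins
  at \<open>j + 1\<close> and reaches \<open>i\<close> already decides the excess.\<close>

lemma excess_extend_window:
  assumes "a \<le> j + 1" "i < a + int W"
  shows "excess b (Infinite (extend a (window a W X))) i j = excess b (Infinite X) i j"
  unfolding excess_def using assms by (intro sum.cong) (auto simp: extend_window)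

lemma excess_extend_window_load:
  assumes "a \<le> j + 1" "i < a + int W"
  shows "excess b (Infinite (extend a (window a W (load T)))) i j = excess b T i j"
  using excess_extend_window[OF assms, of b "load T"] by (simp add: excess_def)

lemma excess_extend_window_le:
  "excess b (Infinite (extend a (window a W (load T)))) i j \<le> excess b T i j"
  unfolding excess_def by (intro sum_mono) (auto simp: extend_window)

text \<open>
  Emptying the buckets outside the window can only lower the distant values of the excess, so it
  does not move the maximum.
\<close>
lemma settled_extend_window:
  assumes "settled b T i L" "a \<le> i - int L + 1" "i < a + int W"
  shows "settled b (Infinite (extend a (window a W (load T)))) i L"
  unfolding settled_def
proof (intro allI impI)
  fix j assume "j < i - int L"
  then obtain j' where j': "j' \<in> {i - int L..<i}" "excess b T i j \<le> excess b T i j'"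
    using assms(1) unfolding settled_def by blast
  moreover have "excess b (Infinite (extend a (window a W (load T)))) i j' = excess b T i j'"
    using j' assms by (intro excess_extend_window_load) auto
  ultimately show "\<exists>j'\<in>{i - int L..<i}. excess b (Infinite (extend a (window a W (load T)))) i j
      \<le> excess b (Infinite (extend a (window a W (load T)))) i j'"
    using excess_extend_window_le[of b a W T i j] by (intro bexI[of _ j']) auto
qed

lemma profile_extend_window:
  assumes "settled b T i L" "L \<ge> 1" "a \<le> i - int L + 1" "i < a + int W"
  shows "profile b (Infinite (extend a (window a W (load T)))) i = profile b T i"
proof -
  have "excess b (Infinite (extend a (window a W (load T)))) i ` {i - int L..<i} = excess b T i ` {i - int L..<i}"
    using assms by (intro image_cong) (auto intro!: excess_extend_window_load)
  then show ?thesis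
    using settled_profile[OF settled_extend_window[OF assms(1,3,4)] assms(2)] settled_profile[OF assms(1,2)] by simp
qed

text \<open>Such a table has finitely many keys, and no excess can be larger than their
  number.\<close>

lemma valid_table_extend: "valid_table b (Infinite (extend a xs))"
  unfolding valid_table.simps
proof (intro allI bdd_aboveI2)
  fix i j
  have "excess b (Infinite (extend a xs)) i j \<le> (\<Sum>k\<in>{j<..i}. int (extend a xs k))"
    unfolding excess_def by (intro sum_mono) auto
  also have "\<dots> = (\<Sum>k\<in>{j<..i} \<inter> {a..<a + int (length xs)}. int (extend a xs k))"
    by (intro sum.mono_neutral_right) (auto simp: extend_def)
  also have "\<dots> \<le> (\<Sum>k\<in>{a..<a + int (length xs)}. int (extend a xs k))"
    by (intro sum_mono2) auto
  finally show "excess b (Infinite (extend a xs)) i j \<le> (\<Sum>k\<in>{a..<a + int (length xs)}. int (extend a xs k))" .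
qed

text \<open>The excess factors through the loads of finitely many buckets, that is, through a
  countable discrete space, on which every function is measurable.\<close>

lemma measurable_excess [measurable]:
  "(\<lambda>X. real_of_int (excess b (Infinite X) i j)) \<in> borel_measurable (poisson_model b' \<alpha>)"
proof -
  define f where "f xs = real_of_int (excess b (Infinite (extend (j + 1) xs)) i j)" for xs
  have "(\<lambda>X. real_of_int (excess b (Infinite X) i j)) = (\<lambda>X. f (window (j + 1) (nat (i - j)) X))"
  proof
    fix X
    show "real_of_int (excess b (Infinite X) i j) = f (window (j + 1) (nat (i - j)) X)"
    proof (cases "j < i")
      case True
      then show ?thesis unfolding f_def by (subst excess_extend_window) auto
    qed (simp add: f_def excess_def)
  qed
  moreover have "(\<lambda>X. f (window (j + 1) (nat (i - j)) X)) \<in> borel_measurable (poisson_model b' \<alpha>)"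
    by (rule measurable_compose[OF measurable_window]) simp
  ultimately show ?thesis by simp
qed

text \<open>All quantifiers range over integers, so the condition is a countable combination of
  comparisons between excesses.\<close>

lemma measurable_settled [measurable]: "Measurable.pred (poisson_model b' \<alpha>) (\<lambda>X. settled b (Infinite X) i L)"
proof -
  define D where "D j X = real_of_int (excess b (Infinite X) i j)" for j X
  have [measurable]: "Measurable.pred (poisson_model b' \<alpha>) (\<lambda>X. D j X \<le> D j' X)" for j j'
    unfolding pred_def D_def by (intro borel_measurable_le measurable_excess)
  have "settled b (Infinite X) i L \<longleftrightarrow> (\<forall>j. j < i - int L \<longrightarrow> (\<exists>j'. j' \<in> {i - int L..<i} \<and> D j X \<le> D j' X))" for X
    unfolding settled_def D_def of_int_le_iff by blast
  then show ?thesis by (simp only:) measurable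
qed

section \<open>Chernoff bound for the number of keys hashed into a set of addresses\<close>

lemma sum_prod_list_lists:
  fixes g :: "'a \<Rightarrow> 'b :: comm_semiring_1"
  assumes "finite A"
  shows "(\<Sum>hs\<in>{hs. set hs \<subseteq> A \<and> length hs = n}. prod_list (map g hs)) = (\<Sum>h\<in>A. g h) ^ n"
proof (induction n)
  case 0
  have "{hs. set hs \<subseteq> A \<and> length hs = 0} = {[]}" by auto
  then show ?case by simp
next
  case (Suc n)
  let ?l = "\<lambda>n. {hs. set hs \<subseteq> A \<and> length hs = n}"
  have im: "?l (Suc n) = (\<lambda>(h, hs). h # hs) ` (A \<times> ?l n)"
    by (auto simp: length_Suc_conv image_iff)
  have inj: "inj_on (\<lambda>(h, hs). h # hs) (A \<times> ?l n)" by (auto simp: inj_on_def)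
  have "(\<Sum>hs\<in>?l (Suc n). prod_list (map g hs)) = (\<Sum>(h, hs)\<in>A \<times> ?l n. g h * prod_list (map g hs))"
    unfolding im sum.reindex[OF inj] by (simp add: case_prod_beta)
  also have "\<dots> = (\<Sum>h\<in>A. g h) * (\<Sum>hs\<in>?l n. prod_list (map g hs))"
    by (simp add: sum_product sum.cartesian_product)
  finally show ?case using Suc.IH by simp
qed

lemma sum_count_list_eq_length_filter:
  "finite S \<Longrightarrow> (\<Sum>c\<in>S. count_list hs c) = length (filter (\<lambda>h. h \<in> S) hs)"
proof (induction hs)
  case (Cons h hs)
  have "(\<Sum>c\<in>S. count_list (h # hs) c) = (\<Sum>c\<in>S. count_list hs c + of_bool (c = h))"
    by (intro sum.cong) auto
  then show ?case using Cons by (simp add: sum.distrib)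
qed simp

text \<open>Exponential Markov inequality. Independence of the keys enters as the factorisation of
  the sum of exp(t Z) over all words into an n-th power, where Z counts the letters in
  \<open>S\<close>.\<close>

lemma card_lists_chernoff:
  fixes t c :: real
  assumes "S \<subseteq> {..<m}" "m \<ge> 1" "t \<ge> 0"
  shows "real (card {hs. set hs \<subseteq> {..<m} \<and> length hs = n \<and> c \<le> real (\<Sum>k\<in>S. count_list hs k)}) / real (m ^ n)
    \<le> exp (real n * real (card S) / real m * (exp t - 1) - t * c)"
proof -
  have fS: "finite S" using assms finite_subset by blast
  define g where "g h = (if h \<in> S then exp t else 1)" for h
  define Z where "Z hs = real (\<Sum>k\<in>S. count_list hs k)" for hs
  let ?U = "{hs. set hs \<subseteq> {..<m} \<and> length hs = n}"
  have fU: "finite ?U" by (intro finite_lists_length_eq) auto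
  have gZ: "prod_list (map g hs) = exp (t * Z hs)" for hs
    unfolding Z_def sum_count_list_eq_length_filter[OF fS]
    by (induction hs) (auto simp: g_def algebra_simps exp_add)
  have "real (card {hs. set hs \<subseteq> {..<m} \<and> length hs = n \<and> c \<le> Z hs}) = (\<Sum>hs\<in>{hs\<in>?U. c \<le> Z hs}. 1)"
    by (simp add: conj_assoc)
  also have "\<dots> \<le> (\<Sum>hs\<in>{hs\<in>?U. c \<le> Z hs}. exp (t * Z hs) * exp (- t * c))"
    using assms by (intro sum_mono) (auto simp flip: exp_add intro: mult_left_mono)
  also have "\<dots> \<le> (\<Sum>hs\<in>?U. exp (t * Z hs) * exp (- t * c))"
    by (intro sum_mono2 fU) auto
  also have "\<dots> = (\<Sum>h<m. g h) ^ n * exp (- t * c)"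
    using sum_prod_list_lists[of "{..<m}" g n] by (simp add: gZ flip: sum_distrib_right)
  also have "(\<Sum>h<m. g h) = (\<Sum>h<m. 1 + (if h \<in> S then exp t - 1 else 0))"
    by (intro sum.cong) (auto simp: g_def)
  also have "\<dots> = real m + real (card S) * (exp t - 1)"
    using assms by (simp add: sum.distrib sum.If_cases Int_absorb1)
  also have "\<dots> = real m * (1 + real (card S) / real m * (exp t - 1))"
    using assms by (simp add: field_simps)
  \<comment> \<open>The inequality 1 + u \<le> exp(u) replaces the binomial generating function by
    the Poisson one, which depends on n / m only.\<close>
  also have "(\<dots>) ^ n \<le> real m ^ n * exp (real (card S) / real m * (exp t - 1)) ^ n"
    unfolding power_mult_distrib using assms
    by (intro mult_left_mono power_mono exp_ge_add_one_self add_nonneg_nonneg mult_nonneg_nonneg) auto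
  finally have "real (card {hs. set hs \<subseteq> {..<m} \<and> length hs = n \<and> c \<le> Z hs})
      \<le> real (m ^ n) * (exp (real (card S) / real m * (exp t - 1)) ^ n * exp (- t * c))"
    by (simp add: mult_ac)
  also have "exp (real (card S) / real m * (exp t - 1)) ^ n * exp (- t * c)
      = exp (real n * real (card S) / real m * (exp t - 1) - t * c)"
    by (simp flip: exp_of_nat_mult exp_add)
  finally show ?thesis using assms unfolding Z_def by (simp add: divide_le_eq mult_ac)
qed

lemma inj_on_mod_interval:
  assumes "l \<le> m" "m \<ge> 1"
  shows "inj_on (\<lambda>k. nat (k mod int m)) {i - int l<..i}"
proof
  fix x y assume xy: "x \<in> {i - int l<..i}" "y \<in> {i - int l<..i}" "nat (x mod int m) = nat (y mod int m)"
  then have "x mod int m = y mod int m" using assms by (simp add: nat_eq_iff)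
  then have "int m dvd x - y" by (simp add: mod_eq_dvd_iff)
  moreover have "\<bar>x - y\<bar> < int m" using xy assms by auto
  ultimately show "x = y" using dvd_imp_le_int[of "x - y" "int m"] by auto
qed

lemma excess_eq_sum_load:
  "excess b T i (i - int l) = int (\<Sum>k\<in>{i - int l<..i}. load T k) - int b * int l"
  by (simp add: excess_def sum_subtractf)

text \<open>The event says that at least b l - b keys fall into l consecutive buckets, whereas at
  most \<beta> b l are expected. Since l \<le> m these buckets are distinct addresses, so the
  Chernoff bound applies. The allowance b in the threshold costs only the constant exp(t b).\<close>

lemma exact_excess_tail:
  fixes t \<beta> :: real
  assumes l: "l \<le> m" and m: "m \<ge> 1" and n: "real n \<le> \<beta> * (real b * real m)" and t: "t \<ge> 0"
  shows "measure (measure_pmf (exact_table m n)) {T. - int b \<le> excess b T i (i - int l)}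
    \<le> exp (t * real b) * exp (real b * (\<beta> * (exp t - 1) - t)) ^ l"
proof -
  define f where "f k = nat (k mod int m)" for k
  have inj: "inj_on f {i - int l<..i}"
    unfolding f_def by (rule inj_on_mod_interval[OF l m])
  define S where "S = f ` {i - int l<..i}"
  have S: "S \<subseteq> {..<m}" using m by (auto simp: S_def f_def nat_less_iff)
  have cS: "card S = l" using inj by (simp add: S_def card_image)
  define c where "c = real b * real l - real b"
  have eq: "- int b \<le> excess b (Cyclic m hs) i (i - int l) \<longleftrightarrow> c \<le> real (\<Sum>k\<in>S. count_list hs k)" for hs
  proof -
    have "(\<Sum>k\<in>S. count_list hs k) = (\<Sum>k\<in>{i - int l<..i}. load (Cyclic m hs) k)"
      unfolding S_def by (subst sum.reindex[OF inj]) (simp add: f_def)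
    then have "- int b \<le> excess b (Cyclic m hs) i (i - int l) \<longleftrightarrow> int b * int l - int b \<le> int (\<Sum>k\<in>S. count_list hs k)"
      unfolding excess_eq_sum_load by auto
    also have "\<dots> \<longleftrightarrow> real_of_int (int b * int l - int b) \<le> real_of_int (int (\<Sum>k\<in>S. count_list hs k))"
      by (rule of_int_le_iff[symmetric])
    finally show ?thesis by (simp add: c_def)
  qed
  let ?V = "{hs. set hs \<subseteq> {..<m} \<and> length hs = n \<and> c \<le> real (\<Sum>k\<in>S. count_list hs k)}"
  have "measure (measure_pmf (exact_table m n)) {T. - int b \<le> excess b T i (i - int l)}
      = real (card (cyclic_tables m n \<inter> {T. - int b \<le> excess b T i (i - int l)})) / real (m ^ n)"
    using m by (simp add: measure_pmf_of_set cyclic_tables_nonempty card_cyclic_tables)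
  also have "cyclic_tables m n \<inter> {T. - int b \<le> excess b T i (i - int l)} = Cyclic m ` ?V"
    unfolding cyclic_tables_image using eq by auto
  also have "card \<dots> = card ?V" by (subst card_image) (auto simp: inj_on_def)
  also have "real (card ?V) / real (m ^ n) \<le> exp (real n * real (card S) / real m * (exp t - 1) - t * c)"
    by (rule card_lists_chernoff[OF S m t])
  also have "\<dots> \<le> exp (\<beta> * real b * real l * (exp t - 1) - t * c)"
  proof -
    have "real n / real m \<le> \<beta> * real b" using n m by (simp add: divide_le_eq mult_ac)
    then have "real n / real m * real l \<le> \<beta> * real b * real l" by (rule mult_right_mono) simp
    then have "real n / real m * real l * (exp t - 1) \<le> \<beta> * real b * real l * (exp t - 1)"
      by (rule mult_right_mono) (use t in simp)
    then have "real n * real l / real m * (exp t - 1) \<le> \<beta> * real b * real l * (exp t - 1)"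
      by (simp only: times_divide_eq_left)
    then show ?thesis unfolding exp_le_cancel_iff cS by (rule diff_right_mono)
  qed
  also have "\<beta> * real b * real l * (exp t - 1) - t * c = t * real b + real l * (real b * (\<beta> * (exp t - 1) - t))"
    by (simp add: c_def algebra_simps)
  also have "exp \<dots> = exp (t * real b) * exp (real b * (\<beta> * (exp t - 1) - t)) ^ l"
    by (simp add: exp_add exp_of_nat_mult)
  finally show ?thesis .
qed

lemma sum_load_cyclic:
  assumes "m \<ge> 1" "set hs \<subseteq> {..<m}"
  shows "(\<Sum>k\<in>{i - int m<..i}. load (Cyclic m hs) k) = length hs"
proof -
  define f where "f k = nat (k mod int m)" for k
  have inj: "inj_on f {i - int m<..i}"
    unfolding f_def using assms by (intro inj_on_mod_interval) auto
  have sub: "f ` {i - int m<..i} \<subseteq> {..<m}" using assms by (auto simp: f_def nat_less_iff)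
  moreover have "card (f ` {i - int m<..i}) = m" using inj by (simp add: card_image)
  ultimately have im: "f ` {i - int m<..i} = {..<m}" by (intro card_subset_eq) auto
  have "(\<Sum>k\<in>{i - int m<..i}. load (Cyclic m hs) k) = (\<Sum>k\<in>f ` {i - int m<..i}. count_list hs k)"
    by (subst sum.reindex[OF inj]) (simp add: f_def)
  also have "\<dots> = length (filter (\<lambda>h. h \<in> {..<m}) hs)"
    unfolding im by (rule sum_count_list_eq_length_filter) simp
  also have "filter (\<lambda>h. h \<in> {..<m}) hs = hs" using assms by (intro filter_True) auto
  finally show ?thesis .
qed

text \<open>An additional full turn adds n - b m to the sum, which is negative for a valid
  table.\<close>

lemma excess_cyclic_period:
  assumes "valid_table b (Cyclic m hs)" "j \<le> i"
  shows "excess b (Cyclic m hs) i (j - int m) \<le> excess b (Cyclic m hs) i j"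
proof -
  have "{j - int m<..i} = {j - int m<..j} \<union> {j<..i}" using assms by auto
  then have "excess b (Cyclic m hs) i (j - int m) = excess b (Cyclic m hs) j (j - int m) + excess b (Cyclic m hs) i j"
    unfolding excess_def by (subst sum.union_disjoint[symmetric]) auto
  moreover have "excess b (Cyclic m hs) j (j - int m) = int (length hs) - int b * int m"
    unfolding excess_eq_sum_load using assms by (subst sum_load_cyclic) auto
  moreover have "int (length hs) \<le> int b * int m" using assms by (simp flip: of_nat_mult)
  ultimately show ?thesis by simp
qed

text \<open>This is the origin of the threshold -b: a start \<open>j\<close> can beat the start
  \<open>i - 1\<close> only if its excess is at least -b.\<close>

lemma excess_pred: "- int b \<le> excess b T i (i - 1)"
proof -
  have "{i - 1<..i} = {i}" by auto
  then show ?thesis by (simp add: excess_def)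
qed

lemma settledI_low:
  assumes "L \<ge> 1" "\<And>l. L < l \<Longrightarrow> \<not> (- int b \<le> excess b T i (i - int l))"
  shows "settled b T i L"
  unfolding settled_def
proof (intro allI impI)
  fix j assume "j < i - int L"
  then have "\<not> (- int b \<le> excess b T i j)" using assms(2)[of "nat (i - j)"] by auto
  then show "\<exists>j'\<in>{i - int L..<i}. excess b T i j \<le> excess b T i j'"
    using excess_pred[of b T i] assms(1) by (intro bexI[of _ "i - 1"]) auto
qed

text \<open>Going once around the cycle lowers the excess, so only one period needs to be checked.\<close>
lemma settled_cyclicI:
  assumes valid: "valid_table b (Cyclic m hs)" and L: "L \<ge> 1"
    and low: "\<And>l. L < l \<Longrightarrow> l \<le> m \<Longrightarrow> \<not> (- int b \<le> excess b (Cyclic m hs) i (i - int l))"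
  shows "settled b (Cyclic m hs) i L"
proof -
  let ?e = "excess b (Cyclic m hs) i"
  have m: "m \<ge> 1" using valid by simp
  have "\<exists>j'\<in>{i - int L..<i}. ?e (i - int l) \<le> ?e j'" if "L < l" for l
    using that
  proof (induction l rule: less_induct)
    case (less l)
    show ?case
    proof (cases "l \<le> m")
      case True
      then show ?thesis using low[OF less.prems True] excess_pred[of b "Cyclic m hs" i] L
        by (intro bexI[of _ "i - 1"]) auto
    next
      case False
      \<comment> \<open>Remove one turn. The new distance l - m is positive; it is either at most
        \<open>L\<close>, so that its start is the required witness, or the induction hypothesis
        applies to it.\<close>
      have step: "?e (i - int l) \<le> ?e (i - int (l - m))"
        using excess_cyclic_period[OF valid, of "i - int (l - m)" i] False by (simp add: of_nat_diff algebra_simps)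
      show ?thesis
      proof (cases "l - m \<le> L")
        case True
        then show ?thesis using step False by (intro bexI[of _ "i - int (l - m)"]) auto
      next
        case notle: False
        then obtain j' where "j'\<in>{i - int L..<i}" "?e (i - int (l - m)) \<le> ?e j'"
          using less.IH[of "l - m"] m False by auto
        then show ?thesis using step by (intro bexI[of _ j']) auto
      qed
    qed
  qed note * = this
  show ?thesis unfolding settled_def
  proof (intro allI impI)
    fix j assume "j < i - int L"
    then show "\<exists>j'\<in>{i - int L..<i}. ?e j \<le> ?e j'" using *[of "nat (i - j)"] by auto
  qed
qed

lemma chernoff_exponent_negative:
  fixes \<beta> :: real
  assumes "0 \<le> \<beta>" "\<beta> < 1"
  obtains t where "t > 0" "\<beta> * (exp t - 1) - t < 0"
proof
  \<comment> \<open>The exponent vanishes at t = 0 with slope \<beta> - 1 < 0, so a small positive t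
    works. With exp(t) \<le> 1 + t + t^2 on [0, 1] it suffices that \<beta> (1 + t) < 1, which half
    of 1 - \<beta> achieves.\<close>
  define t where "t = (1 - \<beta>) / 2"
  have t: "0 < t" "t \<le> 1" using assms by (auto simp: t_def)
  then show "t > 0" by simp
  have "\<beta> * (exp t - 1) \<le> \<beta> * (t + t\<^sup>2)"
    using assms t exp_bound[of t] by (intro mult_left_mono) auto
  also have "\<beta> * (t + t\<^sup>2) = t * (\<beta> * (1 + t))" by (simp add: power2_eq_square algebra_simps)
  also have "\<beta> * (1 + t) < 1"
  proof -
    have "\<beta> * (1 + t) = 1 - (1 - \<beta>) / 2 - (1 - \<beta>)\<^sup>2 / 2" by (simp add: t_def field_simps power2_eq_square)
    also have "\<dots> < 1" using assms by (smt (verit) zero_le_power2 half_gt_zero_iff divide_nonneg_pos)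
    finally show ?thesis .
  qed
  then have "t * (\<beta> * (1 + t)) < t * 1" using t by (intro mult_strict_left_mono) auto
  finally show "\<beta> * (exp t - 1) - t < 0" by simp
qed

text \<open>If the maximum is not attained within distance L, some start at distance l > L has
  excess at least -b. Each such event has probability at most C \<rho>^l, so a union bound over l
  gives the tail of a geometric series, with the same constants in both models.\<close>

lemma settled_tail:
  assumes b: "b \<ge> 1" and \<alpha>: "0 \<le> \<alpha>" "\<alpha> < 1"
  obtains \<tau> :: "nat \<Rightarrow> real" where "\<tau> \<longlonglongrightarrow> 0"
    and "\<And>i L. L \<ge> 1 \<Longrightarrow> measure (poisson_model b \<alpha>) {X. \<not> settled b (Infinite X) i L} \<le> \<tau> L"
    and "\<And>m n i L. L \<ge> 1 \<Longrightarrow> m \<ge> 1 \<Longrightarrow> real n \<le> (1 + \<alpha>) / 2 * (real b * real m) \<Longrightarrow>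
      measure (measure_pmf (exact_table m n)) {T. \<not> settled b T i L} \<le> \<tau> L"
proof -
  define \<beta> where "\<beta> = (1 + \<alpha>) / 2"
  have \<beta>: "0 \<le> \<beta>" "\<beta> < 1" "\<alpha> \<le> \<beta>" using \<alpha> by (auto simp: \<beta>_def)
  obtain t where t: "t > 0" "\<beta> * (exp t - 1) - t < 0" using chernoff_exponent_negative \<beta> by blast
  define \<rho> where "\<rho> = exp (real b * (\<beta> * (exp t - 1) - t))"
  define C where "C = exp (t * real b)"
  have \<rho>: "0 < \<rho>" "\<rho> < 1" using t b by (auto simp: \<rho>_def mult_pos_neg)
  have C: "0 < C" by (simp add: C_def)
  \<comment> \<open>The sum of C \<rho>^l over all l > L.\<close>
  define \<tau> where "\<tau> L = C * \<rho> ^ Suc L / (1 - \<rho>)" for L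
  have exact: "measure (measure_pmf (exact_table m n)) {T. - int b \<le> excess b T i (i - int l)} \<le> C * \<rho> ^ l"
    if "l \<le> m" "m \<ge> 1" "real n \<le> \<beta> * (real b * real m)" for l m n i
    unfolding C_def \<rho>_def by (rule exact_excess_tail) (use that t in auto)
  \<comment> \<open>The event depends on a finite window only, so the exact bound survives the limit.\<close>
  have poisson: "measure (poisson_model b \<alpha>) {X. - int b \<le> excess b (Infinite X) i (i - int l)} \<le> C * \<rho> ^ l" for i l
  proof -
    define a where "a = i - int l + 1"
    define Q where "Q xs \<longleftrightarrow> - int b \<le> excess b (Infinite (extend a xs)) i (i - int l)" for xs
    \<comment> \<open>One convenient sequence of exact models, with \<open>Suc k\<close> buckets:
      its fill ratio tends to \<alpha> and never exceeds \<alpha>, hence stays below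
      \<beta>.\<close>
    define n where "n k = nat \<lfloor>\<alpha> * real b * real (Suc k)\<rfloor>" for k
    have n_real: "real (n k) = real_of_int \<lfloor>\<alpha> * real b * real (Suc k)\<rfloor>" for k
      unfolding n_def using \<alpha> by (intro of_nat_nat) auto
    have "(\<lambda>k. measure (measure_pmf (exact_table (Suc k) (n k))) {T. Q (window a l (load T))})
        \<longlonglongrightarrow> measure (poisson_model b \<alpha>) {X. Q (window a l X)}"
    proof (rule prob_window_tendsto[OF filterlim_Suc _ \<alpha>(1)])
      have "((\<lambda>x::real. real_of_int \<lfloor>\<alpha> * real b * x\<rfloor> / x) \<longlongrightarrow> \<alpha> * real b) at_top"
        by real_asymp
      from filterlim_compose[OF this filterlim_compose[OF filterlim_real_sequentially filterlim_Suc]]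
      show "(\<lambda>k. real (n k) / real (Suc k)) \<longlonglongrightarrow> \<alpha> * real b" unfolding n_real .
    qed
    moreover have "Q (window a l (load T)) \<longleftrightarrow> - int b \<le> excess b T i (i - int l)" for T
      unfolding Q_def by (subst excess_extend_window_load) (auto simp: a_def)
    moreover have "Q (window a l X) \<longleftrightarrow> - int b \<le> excess b (Infinite X) i (i - int l)" for X
      unfolding Q_def by (subst excess_extend_window) (auto simp: a_def)
    ultimately have lim: "(\<lambda>k. measure (measure_pmf (exact_table (Suc k) (n k))) {T. - int b \<le> excess b T i (i - int l)})
        \<longlonglongrightarrow> measure (poisson_model b \<alpha>) {X. - int b \<le> excess b (Infinite X) i (i - int l)}"
      by simp
    show ?thesis
    proof (rule LIMSEQ_le_const2[OF lim], intro exI[of _ l] allI impI exact)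
      fix k
      have "real (n k) \<le> \<alpha> * (real b * real (Suc k))" unfolding n_real by linarith
      also have "\<dots> \<le> \<beta> * (real b * real (Suc k))" using \<beta> by (intro mult_right_mono) auto
      finally show "real (n k) \<le> \<beta> * (real b * real (Suc k))" .
    qed auto
  qed
  have sums: "(\<lambda>k. C * \<rho> ^ (Suc L + k)) sums \<tau> L" for L
    using sums_mult[OF geometric_sums[of \<rho>], of "C * \<rho> ^ Suc L"] \<rho>
    by (simp add: \<tau>_def power_add mult_ac)
  show ?thesis
  proof
    have "(\<lambda>L. C * \<rho> ^ Suc L / (1 - \<rho>)) \<longlonglongrightarrow> C * 0 / (1 - \<rho>)"
      by (intro tendsto_intros filterlim_compose[OF LIMSEQ_power_zero filterlim_Suc]) (use \<rho> in auto)
    then show "\<tau> \<longlonglongrightarrow> 0" by (simp add: \<tau>_def[abs_def])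
  next
    fix i :: int and L :: nat assume L: "L \<ge> 1"
    interpret prob_space "poisson_model b \<alpha>" by (rule prob_space_poisson_model)
    define A where "A k = {X. - int b \<le> excess b (Infinite X) i (i - int (Suc L + k))}" for k
    have A: "A k \<in> events" for k
    proof -
      have "A k = {X \<in> space (poisson_model b \<alpha>). - real b \<le> real_of_int (excess b (Infinite X) i (i - int (Suc L + k)))}"
        by (auto simp: A_def)
      also have "\<dots> \<in> events" by measurable
      finally show ?thesis .
    qed
    have le: "prob (A k) \<le> C * \<rho> ^ (Suc L + k)" for k unfolding A_def by (rule poisson)
    have summ: "summable (\<lambda>k. prob (A k))"
      by (rule summable_comparison_test'[OF sums_summable[OF sums], of 0 _ L]) (use le in auto)
    have "{X. \<not> settled b (Infinite X) i L} \<subseteq> (\<Union>k. A k)"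
    proof
      fix X assume "X \<in> {X. \<not> settled b (Infinite X) i L}"
      then obtain l where l: "L < l" "- int b \<le> excess b (Infinite X) i (i - int l)"
        using settledI_low[OF L] by blast
      then have "X \<in> A (l - Suc L)" by (simp add: A_def)
      then show "X \<in> (\<Union>k. A k)" by blast
    qed
    then have "prob {X. \<not> settled b (Infinite X) i L} \<le> prob (\<Union>k. A k)"
      using A by (intro finite_measure_mono) auto
    also have "\<dots> \<le> (\<Sum>k. prob (A k))"
      using A summ by (intro finite_measure_subadditive_countably) auto
    also have "\<dots> \<le> (\<Sum>k. C * \<rho> ^ (Suc L + k))"
      by (intro suminf_le le summ sums_summable[OF sums])
    also have "\<dots> = \<tau> L" using sums by (rule sums_unique[symmetric])
    finally show "prob {X. \<not> settled b (Infinite X) i L} \<le> \<tau> L" .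
  next
    fix m n L :: nat and i :: int
    assume L: "L \<ge> 1" and m: "m \<ge> 1" and n: "real n \<le> (1 + \<alpha>) / 2 * (real b * real m)"
    let ?M = "measure_pmf (exact_table m n)"
    have n': "real n \<le> \<beta> * (real b * real m)" using n by (simp add: \<beta>_def)
    also have "\<dots> < 1 * (real b * real m)" using \<beta> b m by (intro mult_strict_right_mono) auto
    finally have nb: "n < b * m" by (simp flip: of_nat_mult)
    define A where "A k = {T. - int b \<le> excess b T i (i - int (Suc L + k))}" for k
    \<comment> \<open>The criterion for cyclic tables needs validity, which holds on the support
      because of \<open>nb\<close>; hence the intersection. It looks at distances up to m only, so
      the union is finite.\<close>
    have "{T. \<not> settled b T i L} \<inter> set_pmf (exact_table m n) \<subseteq> (\<Union>k<m - L. A k)"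
    proof
      fix T assume T: "T \<in> {T. \<not> settled b T i L} \<inter> set_pmf (exact_table m n)"
      then obtain hs where hs: "T = Cyclic m hs" "set hs \<subseteq> {..<m}" "length hs = n"
        using set_pmf_of_set[OF cyclic_tables_nonempty[OF m] finite_cyclic_tables, of n]
        by (auto simp: cyclic_tables_def)
      then have "valid_table b T" using nb m by simp
      with T obtain l where l: "L < l" "l \<le> m" "- int b \<le> excess b T i (i - int l)"
        using settled_cyclicI[of b m hs L i] L hs(1) by blast
      then have "T \<in> A (l - Suc L)" "l - Suc L < m - L" by (auto simp: A_def)
      then show "T \<in> (\<Union>k<m - L. A k)" by blast
    qed
    then have "measure ?M {T. \<not> settled b T i L} \<le> measure ?M (\<Union>k<m - L. A k)"
      by (subst measure_Int_set_pmf[symmetric]) (intro measure_pmf.finite_measure_mono, auto)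
    also have "\<dots> \<le> (\<Sum>k<m - L. measure ?M (A k))"
      by (intro measure_pmf.finite_measure_subadditive_finite) auto
    also have "\<dots> \<le> (\<Sum>k<m - L. C * \<rho> ^ (Suc L + k))"
      unfolding A_def by (intro sum_mono exact m n') auto
    also have "\<dots> \<le> (\<Sum>k. C * \<rho> ^ (Suc L + k))"
      using \<rho> C by (intro sum_le_suminf sums_summable[OF sums]) auto
    also have "\<dots> = \<tau> L" using sums by (rule sums_unique[symmetric])
    finally show "measure ?M {T. \<not> settled b T i L} \<le> \<tau> L" .
  qed
qed

section \<open>Approximation by finite windows\<close>

lemma determined_by_window_cong:
  assumes "\<And>i. \<bar>i\<bar> \<le> int N \<Longrightarrow> H i = H' i"
  shows "determined_by_window b P H N \<longleftrightarrow> determined_by_window b P H' N"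
proof -
  have "(\<forall>i. \<bar>i\<bar> \<le> int N \<longrightarrow> h i = H i) \<longleftrightarrow> (\<forall>i. \<bar>i\<bar> \<le> int N \<longrightarrow> h i = H' i)" for h
    using assms by metis
  then show ?thesis unfolding determined_by_window_def by metis
qed

lemma determined_by_window_mono:
  assumes "determined_by_window b P H N" "N \<le> N'"
  shows "determined_by_window b P H N'"
proof -
  obtain D where D: "\<And>T. valid_table b T \<Longrightarrow> (\<forall>i. \<bar>i\<bar> \<le> int N \<longrightarrow> profile b T i = H i) \<Longrightarrow> P T = D"
    using assms(1) unfolding determined_by_window_def by blast
  show ?thesis unfolding determined_by_window_def
    by (rule exI[of _ D]) (use assms(2) in \<open>auto intro!: D\<close>)
qed

lemma determined_by_windowD:
  assumes "determined_by_window b P H N" "valid_table b T" "valid_table b T'"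
    "\<And>i. \<bar>i\<bar> \<le> int N \<Longrightarrow> profile b T i = H i" "\<And>i. \<bar>i\<bar> \<le> int N \<Longrightarrow> profile b T' i = H i"
  shows "P T = P T'"
proof -
  obtain D where "\<And>T. valid_table b T \<Longrightarrow> (\<forall>i. \<bar>i\<bar> \<le> int N \<longrightarrow> profile b T i = H i) \<Longrightarrow> P T = D"
    using assms(1) unfolding determined_by_window_def by blast
  then have "P T = D" "P T' = D" using assms by blast+
  then show ?thesis by simp
qed

lemma settled_mono:
  assumes "settled b T i L" "L \<le> L'"
  shows "settled b T i L'"
  unfolding settled_def
proof (intro allI impI)
  fix j assume "j < i - int L'"
  then have "j < i - int L" using assms by simp
  then obtain j' where "j' \<in> {i - int L..<i}" "excess b T i j \<le> excess b T i j'"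
    using assms(1) unfolding settled_def by blast
  then show "\<exists>j'\<in>{i - int L'..<i}. excess b T i j \<le> excess b T i j'"
    using assms(2) by (intro bexI[of _ j']) auto
qed

section \<open>Central windows and decisive lists of loads\<close>

definition all_settled :: "nat \<Rightarrow> nat \<Rightarrow> nat \<Rightarrow> hash_table \<Rightarrow> bool" where
  "all_settled b N L T \<longleftrightarrow> (\<forall>i\<in>{- int N..int N}. settled b T i L)"

text \<open>The buckets from 1 - N - L to N. These are exactly the ones that enter the excess from
  \<open>j\<close> to \<open>i\<close> for |i| \<le> N and i - L \<le> j < i, since the sum starts
  at j + 1.\<close>

definition central_loads :: "nat \<Rightarrow> nat \<Rightarrow> (int \<Rightarrow> nat) \<Rightarrow> nat list" where
  "central_loads N L = window (1 - int N - int L) (2 * N + L)"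

definition central_table :: "nat \<Rightarrow> nat \<Rightarrow> nat list \<Rightarrow> hash_table" where
  "central_table N L xs = Infinite (extend (1 - int N - int L) xs)"

text \<open>The window condition, read off from the representative table instead of the actual one.
  As a predicate on finite lists it is measurable for free, and its probability passes from the
  Poisson model to the exact one.\<close>

definition decisive :: "nat \<Rightarrow> table_property \<Rightarrow> nat \<Rightarrow> nat \<Rightarrow> nat list \<Rightarrow> bool" where
  "decisive b P N L xs \<longleftrightarrow> determined_by_window b P (profile b (central_table N L xs)) N"

lemma profile_central_table:
  assumes "all_settled b N L T" "L \<ge> 1" "\<bar>i\<bar> \<le> int N"
  shows "profile b (central_table N L (central_loads N L (load T))) i = profile b T i"
  unfolding central_table_def central_loads_def
proof (rule profile_extend_window)
  show "settled b T i L" using assms unfolding all_settled_def by (simp add: abs_le_iff)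
qed (use assms in auto)

lemma decisive_iff:
  assumes "all_settled b N L T" "L \<ge> 1"
  shows "decisive b P N L (central_loads N L (load T)) \<longleftrightarrow> determined_by_window b P (profile b T) N"
  unfolding decisive_def by (rule determined_by_window_cong) (rule profile_central_table[OF assms])

text \<open>The table and its representative are both valid and agree in profile on [-N, N]. Hence
  on this event the law of \<open>P\<close> is a function of finitely many loads.\<close>

lemma property_central_table:
  assumes "all_settled b N L T" "L \<ge> 1" "valid_table b T" "decisive b P N L (central_loads N L (load T))"
  shows "P T = P (central_table N L (central_loads N L (load T)))"
  using assms(4)[unfolded decisive_def] assms(3)
proof (rule determined_by_windowD)
  show "valid_table b (central_table N L (central_loads N L (load T)))"
    unfolding central_table_def by (rule valid_table_extend)
  show "profile b T i = profile b (central_table N L (central_loads N L (load T))) i" if "\<bar>i\<bar> \<le> int N" for i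
    using profile_central_table[OF assms(1,2) that] by simp
qed simp

lemma load_Infinite [simp]: "load (Infinite X) = X"
  by (rule ext) simp

lemma measurable_central_loads [measurable]: "central_loads N L \<in> poisson_model b \<alpha> \<rightarrow>\<^sub>M count_space UNIV"
  unfolding central_loads_def by measurable

lemma measurable_all_settled [measurable]:
  "Measurable.pred (poisson_model b' \<alpha>) (\<lambda>X. all_settled b N L (Infinite X))"
  unfolding all_settled_def by measurable

lemma measurable_decisive [measurable]:
  "Measurable.pred (poisson_model b' \<alpha>) (\<lambda>X. decisive b P N L (central_loads N L X))"
  by (rule measurable_compose[OF measurable_central_loads]) simp

text \<open>The preimages under \<open>f\<close> and \<open>g\<close> differ only inside a null set,
  all of whose subsets are measurable in the completion.\<close>

lemma measurable_completion_AE_eq: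
  assumes g: "g \<in> M \<rightarrow>\<^sub>M N" and f: "f \<in> space M \<rightarrow> space N" and ae: "AE x in M. f x = g x"
  shows "f \<in> completion M \<rightarrow>\<^sub>M N"
proof (rule measurableI)
  obtain Z where Z: "Z \<in> null_sets M" "{x \<in> space M. f x \<noteq> g x} \<subseteq> Z"
    using ae by (auto elim!: AE_E)
  fix A assume A: "A \<in> sets N"
  have eq: "f -` A \<inter> space (completion M) = (g -` A \<inter> space M - Z) \<union> (f -` A \<inter> space M \<inter> Z)"
    using Z(2) by auto
  have "g -` A \<inter> space M - Z \<in> sets (completion M)"
    using measurable_sets[OF g A] Z(1) by auto
  moreover have "f -` A \<inter> space M \<inter> Z \<in> sets (completion M)"
    by (rule null_sets_completion[OF Z(1)]) auto
  ultimately show "f -` A \<inter> space (completion M) \<in> sets (completion M)"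
    unfolding eq by (rule sets.Un)
qed (use f in auto)

lemma (in prob_space) expectation_diff_le_prob:
  fixes f g :: "'a \<Rightarrow> real"
  assumes f: "f \<in> borel_measurable M" "\<And>x. 0 \<le> f x" "\<And>x. f x \<le> 1"
    and g: "g \<in> borel_measurable M" "\<And>x. 0 \<le> g x" "\<And>x. g x \<le> 1"
    and A: "A \<in> events" and ae: "AE x in M. x \<notin> A \<longrightarrow> f x = g x"
  shows "\<bar>expectation f - expectation g\<bar> \<le> prob A"
proof -
  have int: "integrable M f" "integrable M g"
    using f g by (auto intro!: integrable_const_bound[where B = 1])
  have "\<bar>expectation f - expectation g\<bar> = \<bar>\<integral>x. f x - g x \<partial>M\<bar>" using int by simp
  also have "\<dots> \<le> (\<integral>x. \<bar>f x - g x\<bar> \<partial>M)" by (rule integral_abs_bound)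
  also have "\<dots> \<le> (\<integral>x. indicator A x \<partial>M)"
  proof (rule integral_mono_AE)
    show "AE x in M. \<bar>f x - g x\<bar> \<le> indicator A x"
      using ae
    proof eventually_elim
      case (elim x)
      then show ?case using f(2,3)[of x] g(2,3)[of x] by (auto simp: indicator_def)
    qed
    show "integrable M (indicator A :: 'a \<Rightarrow> real)"
      using A by (intro integrable_real_indicator) (auto simp: less_top[symmetric])
  qed (use int in auto)
  also have "\<dots> = prob A" using A by simp
  finally show ?thesis .
qed

definition decided :: "nat \<Rightarrow> table_property \<Rightarrow> nat \<Rightarrow> nat \<Rightarrow> hash_table \<Rightarrow> bool" where
  "decided b P N L T \<longleftrightarrow> L \<ge> 1 \<and> all_settled b N L T \<and> decisive b P N L (central_loads N L (load T))"

definition poisson_property_pmf :: "nat \<Rightarrow> table_property \<Rightarrow> real \<Rightarrow> nat pmf" where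
  "poisson_property_pmf b P \<alpha> = Abs_pmf (poisson_model_law b P \<alpha>)"

context
  fixes b :: nat and \<alpha> :: real and P :: table_property
  assumes b: "b \<ge> 1" and \<alpha>: "0 \<le> \<alpha>" "\<alpha> < 1"
    and window_ae: "AE X in poisson_model b \<alpha>. \<exists>N. determined_by_window b P (profile b (Infinite X)) N"
begin

interpretation M: prob_space "poisson_model b \<alpha>"
  by (rule prob_space_poisson_model)

interpretation CM: prob_space "completion (poisson_model b \<alpha>)"
  by (rule M.prob_space_completion)

text \<open>Never settling implies not being settled at any given L, an event of probability at most
  \<open>\<tau> L\<close>, which tends to 0.\<close>

lemma AE_settled: "AE X in poisson_model b \<alpha>. \<exists>L\<ge>1. settled b (Infinite X) i L"
proof -
  obtain \<tau> where \<tau>: "\<tau> \<longlonglongrightarrow> 0"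
    "\<And>i L. L \<ge> 1 \<Longrightarrow> M.prob {X. \<not> settled b (Infinite X) i L} \<le> \<tau> L"
    "\<And>m n i L. L \<ge> 1 \<Longrightarrow> m \<ge> 1 \<Longrightarrow> real n \<le> (1 + \<alpha>) / 2 * (real b * real m) \<Longrightarrow>
      measure (measure_pmf (exact_table m n)) {T. \<not> settled b T i L} \<le> \<tau> L"
    using settled_tail[OF b \<alpha>] by blast
  let ?Z = "{X \<in> space (poisson_model b \<alpha>). \<forall>L\<ge>1. \<not> settled b (Infinite X) i L}"
  have Z: "?Z \<in> M.events" by measurable
  have "M.prob ?Z \<le> 0"
  proof (rule LIMSEQ_le_const[OF \<tau>(1)], intro exI[of _ 1] allI impI)
    fix L :: nat assume L: "1 \<le> L"
    have "{X \<in> space (poisson_model b \<alpha>). \<not> settled b (Infinite X) i L} \<in> M.events" by measurable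
    then have "M.prob ?Z \<le> M.prob {X. \<not> settled b (Infinite X) i L}"
      using L by (intro M.finite_measure_mono) auto
    then show "M.prob ?Z \<le> \<tau> L" using \<tau>(2)[OF L, of i] by simp
  qed
  then have "M.prob ?Z = 0" by (simp add: order_antisym)
  then have "?Z \<in> null_sets (poisson_model b \<alpha>)" using Z by (simp add: null_sets_def M.emeasure_eq_measure)
  then show ?thesis by (rule AE_I') auto
qed

text \<open>There are countably many positions, and a larger distance is always allowed, so finitely
  many positions share the maximum of their distances. Settledness also bounds the excesses, which
  makes almost every Poisson table valid.\<close>

lemma AE_all_settled:
  "AE X in poisson_model b \<alpha>. valid_table b (Infinite X) \<and> (\<forall>N. \<exists>L\<ge>1. all_settled b N L (Infinite X))"
proof -
  have "AE X in poisson_model b \<alpha>. \<forall>i. \<exists>L\<ge>1. settled b (Infinite X) i L"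
    unfolding AE_all_countable by (intro allI AE_settled)
  then show ?thesis
  proof eventually_elim
    case (elim X)
    then obtain l where l: "\<And>i. l i \<ge> 1" "\<And>i. settled b (Infinite X) i (l i)" by metis
    have "valid_table b (Infinite X)" using settled_bdd_above[OF l(2,1)] by simp
    moreover have "\<exists>L\<ge>1. all_settled b N L (Infinite X)" for N
    proof (intro exI conjI)
      let ?L = "Max (l ` {- int N..int N})"
      have le: "l i \<le> ?L" if "i \<in> {- int N..int N}" for i using that by (intro Max_ge) auto
      show "?L \<ge> 1" by (rule order_trans[OF l(1)[of 0] le]) simp
      show "all_settled b N ?L (Infinite X)"
        unfolding all_settled_def using settled_mono[OF l(2) le] by blast
    qed
    ultimately show ?case by blast
  qed
qed

lemma measurable_decided [measurable]:
  "Measurable.pred (poisson_model b \<alpha>) (\<lambda>X. decided b P N L (Infinite X))"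
  unfolding decided_def load_Infinite by measurable

lemma AE_decided:
  "AE X in poisson_model b \<alpha>. valid_table b (Infinite X) \<and> (\<exists>N L. decided b P N L (Infinite X))"
  using AE_all_settled window_ae
proof eventually_elim
  case (elim X)
  then obtain N where N: "determined_by_window b P (profile b (Infinite X)) N" by blast
  obtain L where L: "L \<ge> 1" "all_settled b N L (Infinite X)" using elim by blast
  have "decided b P N L (Infinite X)" unfolding decided_def using L N decisive_iff[OF L(2,1)] by blast
  then show ?case using elim by blast
qed

lemma property_decided:
  assumes "decided b P N L T" "valid_table b T"
  shows "P T = P (central_table N L (central_loads N L (load T)))"
  using assms property_central_table unfolding decided_def by blast

text \<open>Almost every \<open>X\<close> is decided by some pair (N, L). Taking the first such pair
  in an enumeration gives a countable case distinction into functions of finite windows; it is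
  measurable and agrees with \<open>P\<close> off a null set.\<close>

lemma measurable_property:
  "(\<lambda>X. measure_pmf (P (Infinite X))) \<in> completion (poisson_model b \<alpha>) \<rightarrow>\<^sub>M subprob_algebra (count_space UNIV)"
proof (rule measurable_completion_AE_eq)
  define D where "D k X \<longleftrightarrow> decided b P (fst (prod_decode k)) (snd (prod_decode k)) (Infinite X)" for k X
  define g where "g k X = measure_pmf (P (central_table (fst (prod_decode k)) (snd (prod_decode k))
     (central_loads (fst (prod_decode k)) (snd (prod_decode k)) X)))" for k X
  have [measurable]: "Measurable.pred (poisson_model b \<alpha>) (D k)" for k
    unfolding D_def by measurable
  have least: "(\<lambda>X. LEAST k. D k X) \<in> poisson_model b \<alpha> \<rightarrow>\<^sub>M count_space UNIV"
    by measurable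
  have "g k \<in> poisson_model b \<alpha> \<rightarrow>\<^sub>M subprob_algebra (count_space UNIV)" for k
    unfolding g_def
    by (rule measurable_compose[OF measurable_central_loads])
       (simp add: space_subprob_algebra measure_pmf.subprob_space_axioms)
  then show "(\<lambda>X. g (LEAST k. D k X) X) \<in> poisson_model b \<alpha> \<rightarrow>\<^sub>M subprob_algebra (count_space UNIV)"
    using least by (rule measurable_compose_countable)
  show "AE X in poisson_model b \<alpha>. measure_pmf (P (Infinite X)) = g (LEAST k. D k X) X"
    using AE_decided
  proof eventually_elim
    case (elim X)
    then obtain N L where "decided b P N L (Infinite X)" by blast
    then have "D (prod_encode (N, L)) X" by (simp add: D_def)
    then have "D (LEAST k. D k X) X" by (rule LeastI)
    then show ?case using elim property_decided[of _ _ "Infinite X"] by (simp add: D_def g_def)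
  qed
qed (simp add: space_subprob_algebra measure_pmf.subprob_space_axioms)

lemma poisson_model_law_eq: "poisson_model_law b P \<alpha> = measure_pmf (poisson_property_pmf b P \<alpha>)"
proof -
  have "prob_space (poisson_model_law b P \<alpha>)"
    unfolding poisson_model_law_def
    by (rule CM.prob_space_bind[OF _ measurable_property]) (simp add: measure_pmf.prob_space_axioms)
  moreover have "sets (poisson_model_law b P \<alpha>) = UNIV"
    unfolding poisson_model_law_def by (subst sets_bind[where N = "count_space UNIV"]) auto
  ultimately show ?thesis unfolding poisson_property_pmf_def by (rule measure_pmf_Abs_pmf[symmetric])
qed

lemma pmf_poisson_property:
  "pmf (poisson_property_pmf b P \<alpha>) k = CM.expectation (\<lambda>X. pmf (P (Infinite X)) k)"
  unfolding pmf.rep_eq poisson_model_law_eq[symmetric] poisson_model_law_def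
  by (rule CM.measure_bind[OF measurable_property]) simp

text \<open>The order of choice matters: N comes from the almost sure hypothesis by continuity from
  below, and then L makes 2 N + 1 copies of the tail small. The exact half speaks of settling only,
  which has a uniform tail bound; decisiveness is carried over by a limit afterwards.\<close>

lemma decided_likely:
  assumes "\<epsilon> > 0"
  shows "\<exists>N L. L \<ge> 1 \<and> M.prob {X. \<not> decided b P N L (Infinite X)} < \<epsilon> \<and>
    (\<forall>m n. m \<ge> 1 \<longrightarrow> real n \<le> (1 + \<alpha>) / 2 * (real b * real m) \<longrightarrow>
      measure (measure_pmf (exact_table m n)) {T. \<not> all_settled b N L T} < \<epsilon>)"
proof -
  obtain \<tau> where \<tau>: "\<tau> \<longlonglongrightarrow> 0"
    "\<And>i L. L \<ge> 1 \<Longrightarrow> M.prob {X. \<not> settled b (Infinite X) i L} \<le> \<tau> L"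
    "\<And>m n i L. L \<ge> 1 \<Longrightarrow> m \<ge> 1 \<Longrightarrow> real n \<le> (1 + \<alpha>) / 2 * (real b * real m) \<Longrightarrow>
      measure (measure_pmf (exact_table m n)) {T. \<not> settled b T i L} \<le> \<tau> L"
    using settled_tail[OF b \<alpha>] by blast
  \<comment> \<open>Allowing any N' \<le> N makes these sets increase with N.\<close>
  define C where "C N = {X \<in> space (poisson_model b \<alpha>). \<exists>N'. N' \<le> N \<and> (\<exists>L. decided b P N' L (Infinite X))}" for N
  have C[measurable]: "C N \<in> M.events" for N unfolding C_def by measurable
  have "incseq C" unfolding C_def incseq_def using le_trans by blast
  then have "(\<lambda>N. M.prob (C N)) \<longlonglongrightarrow> M.prob (\<Union>N. C N)"
    using C by (intro M.finite_Lim_measure_incseq) auto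
  moreover have "M.prob (\<Union>N. C N) = 1"
  proof (rule M.prob_eq_1[THEN iffD2])
    show "AE X in poisson_model b \<alpha>. X \<in> (\<Union>N. C N)"
      using AE_decided by eventually_elim (auto simp: C_def)
  qed (use C in auto)
  ultimately have "\<forall>\<^sub>F N in sequentially. M.prob (C N) > 1 - \<epsilon> / 2"
    using assms by (intro order_tendstoD(1)) auto
  then obtain N where N: "M.prob (C N) > 1 - \<epsilon> / 2" by (auto simp: eventually_sequentially)
  have lim0: "(\<lambda>L. real (card {- int N..int N}) * \<tau> L) \<longlonglongrightarrow> real (card {- int N..int N}) * 0"
    by (intro tendsto_mult tendsto_const \<tau>)
  have "\<forall>\<^sub>F L in sequentially. real (card {- int N..int N}) * \<tau> L < \<epsilon> / 2"
    by (rule order_tendstoD(2)[OF lim0]) (use assms in simp)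
  then have "\<forall>\<^sub>F L in sequentially. real (card {- int N..int N}) * \<tau> L < \<epsilon> / 2 \<and> L \<ge> 1"
    using eventually_ge_at_top by eventually_elim auto
  then obtain L where L: "real (card {- int N..int N}) * \<tau> L < \<epsilon> / 2" "L \<ge> 1"
    by (auto simp: eventually_sequentially)
  have union: "{T. \<not> all_settled b N L T} = (\<Union>i\<in>{- int N..int N}. {T. \<not> settled b T i L})"
    by (auto simp: all_settled_def)
  show ?thesis
  proof (rule exI[of _ N], rule exI[of _ L], intro conjI)
    show "L \<ge> 1" by fact
  next
    show "\<forall>m n. m \<ge> 1 \<longrightarrow> real n \<le> (1 + \<alpha>) / 2 * (real b * real m) \<longrightarrow>
      measure (measure_pmf (exact_table m n)) {T. \<not> all_settled b N L T} < \<epsilon>"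
    proof (intro allI impI)
      fix m n :: nat assume mn: "m \<ge> 1" "real n \<le> (1 + \<alpha>) / 2 * (real b * real m)"
      have "measure (measure_pmf (exact_table m n)) {T. \<not> all_settled b N L T}
          \<le> (\<Sum>i\<in>{- int N..int N}. measure (measure_pmf (exact_table m n)) {T. \<not> settled b T i L})"
        unfolding union by (intro measure_pmf.finite_measure_subadditive_finite) auto
      also have "\<dots> \<le> (\<Sum>i\<in>{- int N..int N}. \<tau> L)" by (intro sum_mono \<tau>(3) mn L)
      also have "\<dots> < \<epsilon>" using L assms by simp
      finally show "measure (measure_pmf (exact_table m n)) {T. \<not> all_settled b N L T} < \<epsilon>" .
    qed
  next
    have S: "{X. \<not> settled b (Infinite X) i L} \<in> M.events" for i
    proof -
      have "{X \<in> space (poisson_model b \<alpha>). \<not> settled b (Infinite X) i L} \<in> M.events" by measurable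
      then show ?thesis by simp
    qed
    have "M.prob (\<Union>i\<in>{- int N..int N}. {X. \<not> settled b (Infinite X) i L})
        \<le> (\<Sum>i\<in>{- int N..int N}. M.prob {X. \<not> settled b (Infinite X) i L})"
      using S by (intro M.finite_measure_subadditive_finite) auto
    also have "\<dots> \<le> (\<Sum>i\<in>{- int N..int N}. \<tau> L)" by (intro sum_mono \<tau>(2) L)
    also have "\<dots> < \<epsilon> / 2" using L by simp
    finally have small: "M.prob (\<Union>i\<in>{- int N..int N}. {X. \<not> settled b (Infinite X) i L}) < \<epsilon> / 2" .
    have "{X \<in> space (poisson_model b \<alpha>). \<not> decided b P N L (Infinite X)} \<in> M.events" by measurable
    then have "M.prob {X. \<not> decided b P N L (Infinite X)}
        \<le> M.prob ((space (poisson_model b \<alpha>) - C N) \<union> (\<Union>i\<in>{- int N..int N}. {X. \<not> settled b (Infinite X) i L}))"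
    proof (intro M.finite_measure_mono_AE)
      show "AE X in poisson_model b \<alpha>. X \<in> {X. \<not> decided b P N L (Infinite X)} \<longrightarrow>
        X \<in> (space (poisson_model b \<alpha>) - C N) \<union> (\<Union>i\<in>{- int N..int N}. {X. \<not> settled b (Infinite X) i L})"
        using AE_decided
      proof eventually_elim
        case (elim X)
        \<comment> \<open>Settledness turns decisiveness into a statement about the true profile;
          there the window may grow from N' to N, and the distance L' may be exchanged for
          L.\<close>
        have "decided b P N L (Infinite X)" if X: "X \<in> C N" "all_settled b N L (Infinite X)"
        proof -
          obtain N' L' where N': "N' \<le> N" "decided b P N' L' (Infinite X)" using X by (auto simp: C_def)
          then have "determined_by_window b P (profile b (Infinite X)) N'"
            using decisive_iff[of b N' L' "Infinite X" P] unfolding decided_def by blast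
          then have "determined_by_window b P (profile b (Infinite X)) N"
            using N'(1) by (rule determined_by_window_mono)
          then show ?thesis unfolding decided_def using L(2) X(2) decisive_iff[OF X(2) L(2)] by blast
        qed
        then show ?case by (auto simp: all_settled_def)
      qed
    qed (use S sets.compl_sets[OF C] in \<open>auto intro!: sets.Un sets.finite_UN\<close>)
    also have "\<dots> \<le> M.prob (space (poisson_model b \<alpha>) - C N)
        + M.prob (\<Union>i\<in>{- int N..int N}. {X. \<not> settled b (Infinite X) i L})"
      using S by (intro measure_Un_le sets.finite_UN sets.compl_sets C) auto
    also have "M.prob (space (poisson_model b \<alpha>) - C N) < \<epsilon> / 2" using N M.prob_compl[OF C] by simp
    finally show "M.prob {X. \<not> decided b P N L (Infinite X)} < \<epsilon>" using small by simp
  qed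
qed

text \<open>The error splits into four quarters: exact tables that are not settled, exact tables
  that are not decisive, the difference of the expectations of one function of the central loads,
  and Poisson tables that are not decided.\<close>

lemma pmf_exact_property_tendsto:
  assumes m: "filterlim m at_top sequentially"
    and lim: "(\<lambda>k. real (n k) / (real b * real (m k))) \<longlonglongrightarrow> \<alpha>"
  shows "(\<lambda>k. pmf (bind_pmf (exact_table (m k) (n k)) P) x) \<longlonglongrightarrow> pmf (poisson_property_pmf b P \<alpha>) x"
proof (rule LIMSEQ_I)
  fix \<epsilon> :: real assume "\<epsilon> > 0"
  then have e: "\<epsilon> / 4 > 0" by simp
  obtain N L where L: "L \<ge> 1" and pois: "M.prob {X. \<not> decided b P N L (Infinite X)} < \<epsilon> / 4"
    and exact: "\<forall>m n. m \<ge> 1 \<longrightarrow> real n \<le> (1 + \<alpha>) / 2 * (real b * real m) \<longrightarrow>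
      measure (measure_pmf (exact_table m n)) {T. \<not> all_settled b N L T} < \<epsilon> / 4"
    using decided_likely[OF e] by blast
  have lim': "(\<lambda>k. real (n k) / real (m k)) \<longlonglongrightarrow> \<alpha> * real b"
    using tendsto_mult_right[OF lim, of "real b"] b by simp
  define F where "F T = pmf (P T) x" for T
  define F' where "F' xs = F (central_table N L xs)" for xs
  have F: "0 \<le> F T" "F T \<le> 1" for T by (auto simp: F_def pmf_le_1)
  let ?E = "\<lambda>k. measure_pmf (exact_table (m k) (n k))"
  have "(\<lambda>k. LINT T|?E k. F' (central_loads N L (load T))) \<longlonglongrightarrow> M.expectation (\<lambda>X. F' (central_loads N L X))"
    unfolding central_loads_def using F
    by (intro expectation_window_tendsto[OF m lim' \<alpha>(1), where B = 1]) (auto simp: F'_def)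
  from LIMSEQ_D[OF this e]
  have ev1: "\<forall>\<^sub>F k in sequentially. \<bar>(LINT T|?E k. F' (central_loads N L (load T))) - M.expectation (\<lambda>X. F' (central_loads N L X))\<bar> < \<epsilon> / 4"
    by (auto simp: eventually_sequentially)
  have "(\<lambda>k. measure (?E k) {T. \<not> decisive b P N L (central_loads N L (load T))})
      \<longlonglongrightarrow> M.prob {X. \<not> decisive b P N L (central_loads N L X)}"
    unfolding central_loads_def by (rule prob_window_tendsto[OF m lim' \<alpha>(1)])
  \<comment> \<open>A list that is not decisive leaves the table undecided, so the Poisson bound
    applies.\<close>
  moreover have "M.prob {X. \<not> decisive b P N L (central_loads N L X)} < \<epsilon> / 4"
  proof (rule le_less_trans[OF M.finite_measure_mono pois])
    have "{X \<in> space (poisson_model b \<alpha>). \<not> decided b P N L (Infinite X)} \<in> M.events" by measurable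
    then show "{X. \<not> decided b P N L (Infinite X)} \<in> M.events" by simp
  qed (auto simp: decided_def)
  ultimately have ev2: "\<forall>\<^sub>F k in sequentially. measure (?E k) {T. \<not> decisive b P N L (central_loads N L (load T))} < \<epsilon> / 4"
    by (rule order_tendstoD(2))
  have "\<forall>\<^sub>F k in sequentially. real (n k) / (real b * real (m k)) < (1 + \<alpha>) / 2"
    using \<alpha> by (intro order_tendstoD(2)[OF lim]) auto
  moreover have "\<forall>\<^sub>F k in sequentially. m k \<ge> 1"
    using m eventually_ge_at_top[of 1] unfolding filterlim_iff by blast
  moreover note ev1 ev2
  ultimately have "\<forall>\<^sub>F k in sequentially.
      norm (pmf (bind_pmf (exact_table (m k) (n k)) P) x - pmf (poisson_property_pmf b P \<alpha>) x) < \<epsilon>"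
  proof eventually_elim
    case (elim k)
    have nle: "real (n k) \<le> (1 + \<alpha>) / 2 * (real b * real (m k))"
      using elim(1,2) b by (simp add: divide_less_eq)
    have "(1 + \<alpha>) / 2 * (real b * real (m k)) < 1 * (real b * real (m k))"
      using \<alpha> b elim(2) by (intro mult_strict_right_mono) auto
    with nle have nb: "n k < b * m k" by (simp flip: of_nat_mult)
    have "\<bar>(LINT T|?E k. F T) - (LINT T|?E k. F' (central_loads N L (load T)))\<bar> \<le> measure (?E k)
        ({T. \<not> all_settled b N L T} \<union> {T. \<not> decisive b P N L (central_loads N L (load T))})"
    proof (rule measure_pmf.expectation_diff_le_prob)
      show "AE T in ?E k. T \<notin> {T. \<not> all_settled b N L T} \<union> {T. \<not> decisive b P N L (central_loads N L (load T))}
          \<longrightarrow> F T = F' (central_loads N L (load T))"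
        unfolding AE_measure_pmf_iff
      proof (intro ballI impI)
        fix T assume "T \<in> set_pmf (exact_table (m k) (n k))"
        then have "T \<in> cyclic_tables (m k) (n k)"
          using set_pmf_of_set[OF cyclic_tables_nonempty finite_cyclic_tables] elim(2) by blast
        then have "valid_table b T" using nb elim(2) by (auto simp: cyclic_tables_def)
        moreover assume "T \<notin> {T. \<not> all_settled b N L T} \<union> {T. \<not> decisive b P N L (central_loads N L (load T))}"
        ultimately show "F T = F' (central_loads N L (load T))"
          using property_central_table[OF _ L, of b N T P] by (simp add: F_def F'_def)
      qed
    qed (auto simp: F F'_def)
    also have "\<dots> \<le> measure (?E k) {T. \<not> all_settled b N L T}
        + measure (?E k) {T. \<not> decisive b P N L (central_loads N L (load T))}"
      by (intro measure_Un_le) auto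
    also have "\<dots> < \<epsilon> / 4 + \<epsilon> / 4" by (intro add_strict_mono exact[rule_format] nle elim)
    finally have d1: "\<bar>(LINT T|?E k. F T) - (LINT T|?E k. F' (central_loads N L (load T)))\<bar> < \<epsilon> / 4 + \<epsilon> / 4" .
    have ev: "{X. \<not> decided b P N L (Infinite X)} \<in> M.events"
    proof -
      have "{X \<in> space (poisson_model b \<alpha>). \<not> decided b P N L (Infinite X)} \<in> M.events" by measurable
      then show ?thesis by simp
    qed
    have F'm: "(\<lambda>X. F' (central_loads N L X)) \<in> borel_measurable (poisson_model b \<alpha>)"
      by (rule measurable_compose[OF measurable_central_loads]) simp
    \<comment> \<open>\<open>F (Infinite X)\<close> is known to be measurable only for the
      completion, so the comparison is made there; the function of the central loads has the same
      integral in both spaces.\<close>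
    have "\<bar>CM.expectation (\<lambda>X. F (Infinite X)) - CM.expectation (\<lambda>X. F' (central_loads N L X))\<bar>
        \<le> CM.prob {X. \<not> decided b P N L (Infinite X)}"
    proof (rule CM.expectation_diff_le_prob)
      have "(\<lambda>X. measure (measure_pmf (P (Infinite X))) {x}) \<in> borel_measurable (completion (poisson_model b \<alpha>))"
        by (rule measurable_compose[OF measurable_property measurable_measure_subprob_algebra]) simp
      then show "(\<lambda>X. F (Infinite X)) \<in> borel_measurable (completion (poisson_model b \<alpha>))"
        by (simp add: F_def pmf.rep_eq)
      show "AE X in completion (poisson_model b \<alpha>). X \<notin> {X. \<not> decided b P N L (Infinite X)} \<longrightarrow>
          F (Infinite X) = F' (central_loads N L X)"
        using AE_completion[OF AE_decided]
      proof eventually_elim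
        case (elim X)
        then show ?case using property_decided[of N L "Infinite X"] by (auto simp: F_def F'_def)
      qed
    qed (use F F'm ev in \<open>auto simp: F'_def intro: measurable_completion\<close>)
    also have "\<dots> < \<epsilon> / 4" using pois ev by simp
    finally have d2: "\<bar>CM.expectation (\<lambda>X. F (Infinite X)) - M.expectation (\<lambda>X. F' (central_loads N L X))\<bar> < \<epsilon> / 4"
      using integral_completion[OF F'm] by simp
    have "pmf (bind_pmf (exact_table (m k) (n k)) P) x = (LINT T|?E k. F T)"
      by (simp add: pmf_bind F_def)
    moreover have "pmf (poisson_property_pmf b P \<alpha>) x = CM.expectation (\<lambda>X. F (Infinite X))"
      by (simp add: pmf_poisson_property F_def)
    ultimately show ?case using d1 d2 elim(3) unfolding real_norm_def by linarith
  qed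
  then show "\<exists>k0. \<forall>k\<ge>k0. norm (pmf (bind_pmf (exact_table (m k) (n k)) P) x - pmf (poisson_property_pmf b P \<alpha>) x) < \<epsilon>"
    unfolding eventually_sequentially .
qed

end

section \<open>The Poisson transform and the residue\<close>

lemma converges_in_distribution_pmf:
  assumes "\<And>x. (\<lambda>k. pmf (p k) x) \<longlonglongrightarrow> pmf p0 x"
  shows "converges_in_distribution (\<lambda>k. measure_pmf (p k)) (measure_pmf p0)"
proof -
  have "cdf (distr (measure_pmf r) borel real) x = measure (measure_pmf r) {k. real k \<le> x}" for r x
    unfolding cdf_def by (subst measure_distr) (auto simp: vimage_def)
  then show ?thesis
    unfolding converges_in_distribution_def weak_conv_m_def weak_conv_def
    using measure_pmf_tendsto[OF assms] by simp
qed

lemma norm_pgf_le: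
  assumes "norm q \<le> 1"
  shows "norm (pgf (measure_pmf p) q) \<le> 1"
proof -
  have bound: "norm (q ^ k) \<le> 1" for k using assms by (simp add: norm_power power_le_one)
  have "norm (pgf (measure_pmf p) q) \<le> (LINT k|measure_pmf p. norm (q ^ k))"
    unfolding pgf_def by (rule integral_norm_bound)
  also have "\<dots> \<le> 1"
    using bound by (intro measure_pmf.integral_le_const measure_pmf.integrable_const_bound[where B = 1]) auto
  finally show ?thesis .
qed

lemma pgf_tendsto:
  assumes "\<And>x. (\<lambda>k. pmf (p k) x) \<longlonglongrightarrow> pmf p0 x" "norm q \<le> 1"
  shows "(\<lambda>k. pgf (measure_pmf (p k)) q) \<longlonglongrightarrow> pgf (measure_pmf p0) q"
  unfolding pgf_def using assms
  by (intro expectation_pmf_tendsto[where B = 1]) (auto simp: norm_power power_le_one)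

section \<open>Poisson moments and concentration of the Poisson transform\<close>

lemma sums_poisson_mass: "(\<lambda>n. \<mu> ^ n / fact n) sums exp (\<mu> :: real)"
  using exp_converges[of \<mu>] by (simp add: divide_inverse mult.commute)

text \<open>The factorial moments follow by shifting the index, and (n - \<mu>)^2 = n (n - 1) + (1 -
  2 \<mu>) n + \<mu>^2. The weights are not normalised, hence the factor
  \<open>exp \<mu>\<close>.\<close>

lemma sums_poisson_variance:
  fixes \<mu> :: real
  shows "(\<lambda>n. \<mu> ^ n / fact n * (real n - \<mu>)\<^sup>2) sums (\<mu> * exp \<mu>)"
proof -
  have 1: "(\<lambda>n. \<mu> ^ n / fact n * real n) sums (\<mu> * exp \<mu>)"
  proof -
    have eq: "\<mu> ^ Suc n / fact (Suc n) * real (Suc n) = \<mu> * (\<mu> ^ n / fact n)" for n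
      by (simp add: field_simps del: of_nat_Suc)
    have "(\<lambda>n. \<mu> ^ Suc n / fact (Suc n) * real (Suc n)) sums (\<mu> * exp \<mu>)"
      unfolding eq by (intro sums_mult sums_poisson_mass)
    then show ?thesis by (subst (asm) sums_Suc_iff) simp
  qed
  have 2: "(\<lambda>n. \<mu> ^ n / fact n * (real n * (real n - 1))) sums (\<mu> * (\<mu> * exp \<mu>))"
  proof -
    have eq: "\<mu> ^ Suc n / fact (Suc n) * (real (Suc n) * (real (Suc n) - 1)) = \<mu> * (\<mu> ^ n / fact n * real n)" for n
    proof -
      have "real (Suc n) - 1 = real n" by simp
      then show ?thesis unfolding \<open>real (Suc n) - 1 = real n\<close> by (simp add: field_simps del: of_nat_Suc)
    qed
    have "(\<lambda>n. \<mu> ^ Suc n / fact (Suc n) * (real (Suc n) * (real (Suc n) - 1))) sums (\<mu> * (\<mu> * exp \<mu>))"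
      unfolding eq by (intro sums_mult 1)
    then show ?thesis by (subst (asm) sums_Suc_iff) simp
  qed
  have "(\<lambda>n. \<mu> ^ n / fact n * (real n * (real n - 1)) + (1 - 2 * \<mu>) * (\<mu> ^ n / fact n * real n) + \<mu>\<^sup>2 * (\<mu> ^ n / fact n))
      sums (\<mu> * (\<mu> * exp \<mu>) + (1 - 2 * \<mu>) * (\<mu> * exp \<mu>) + \<mu>\<^sup>2 * exp \<mu>)"
    by (intro sums_add sums_mult 1 2 sums_poisson_mass)
  moreover have "\<mu> * (\<mu> * exp \<mu>) + (1 - 2 * \<mu>) * (\<mu> * exp \<mu>) + \<mu>\<^sup>2 * exp \<mu> = \<mu> * exp \<mu>"
    by (simp add: algebra_simps power2_eq_square)
  moreover have "\<mu> ^ n / fact n * (real n * (real n - 1)) + (1 - 2 * \<mu>) * (\<mu> ^ n / fact n * real n) + \<mu>\<^sup>2 * (\<mu> ^ n / fact n)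
      = \<mu> ^ n / fact n * (real n - \<mu>)\<^sup>2" for n
  proof -
    define w where "w = \<mu> ^ n / fact n"
    show ?thesis unfolding w_def[symmetric] by (simp add: algebra_simps power2_eq_square)
  qed
  ultimately show ?thesis by simp
qed

text \<open>If no \<delta> and M worked, the counterexamples for \<delta> = 1 / (k + 1) and M = k
  would form a sequence along which the assumed limit fails.\<close>

lemma sequential_limit_uniform:
  fixes f :: "nat \<Rightarrow> nat \<Rightarrow> complex"
  assumes lim: "\<And>m n. filterlim m at_top sequentially \<Longrightarrow>
      (\<lambda>k. real (n k) / (real b * real (m k))) \<longlonglongrightarrow> \<alpha> \<Longrightarrow> (\<lambda>k. f (m k) (n k)) \<longlonglongrightarrow> l"
    and "\<epsilon> > 0"
  shows "\<exists>\<delta>>0. \<exists>M. \<forall>m\<ge>M. \<forall>n. \<bar>real n / (real b * real m) - \<alpha>\<bar> < \<delta> \<longrightarrow> norm (f m n - l) < \<epsilon>"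
proof (rule ccontr)
  assume "\<not> ?thesis"
  then have "\<exists>m n. m \<ge> k \<and> \<bar>real n / (real b * real m) - \<alpha>\<bar> < 1 / real (Suc k) \<and> \<not> norm (f m n - l) < \<epsilon>" for k
    by (metis of_nat_0_less_iff zero_less_Suc zero_less_divide_1_iff)
  then obtain m n where mn: "\<And>k. m k \<ge> k" "\<And>k. \<bar>real (n k) / (real b * real (m k)) - \<alpha>\<bar> < 1 / real (Suc k)"
    "\<And>k. \<not> norm (f (m k) (n k) - l) < \<epsilon>" by metis
  have "filterlim m at_top sequentially"
    by (rule filterlim_at_top_mono[OF filterlim_ident]) (use mn(1) in auto)
  moreover have "(\<lambda>k. real (n k) / (real b * real (m k))) \<longlonglongrightarrow> \<alpha>"
  proof (rule LIM_zero_cancel, rule Lim_null_comparison[OF _ LIMSEQ_Suc[OF lim_1_over_n]])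
    show "\<forall>\<^sub>F k in sequentially. norm (real (n k) / (real b * real (m k)) - \<alpha>) \<le> 1 / real (Suc k)"
      using mn(2) by (intro always_eventually allI) (simp add: less_imp_le)
  qed
  ultimately have "(\<lambda>k. f (m k) (n k)) \<longlonglongrightarrow> l" by (rule lim)
  from LIMSEQ_D[OF this \<open>\<epsilon> > 0\<close>] show False using mn(3) by blast
qed

text \<open>Chebyshev's inequality in pointwise form: the error is at most \<epsilon> / 2 plus a
  multiple of (n - m x)^2 for every n. Summing against the Poisson weights turns the square into the
  variance m x, and the multiple is of order 1 / m^2.\<close>

lemma poisson_transform_tendsto:
  fixes f :: "nat \<Rightarrow> nat \<Rightarrow> complex"
  assumes lim: "\<And>m n. filterlim m at_top sequentially \<Longrightarrow>
      (\<lambda>k. real (n k) / (real b * real (m k))) \<longlonglongrightarrow> \<alpha> \<Longrightarrow> (\<lambda>k. f (m k) (n k)) \<longlonglongrightarrow> l"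
    and f: "\<And>m n. norm (f m n) \<le> 1" and l: "norm l \<le> 1" and b: "b \<ge> 1" and \<alpha>: "\<alpha> \<ge> 0"
  shows "(\<lambda>m. poisson_transform m (f m) (real b * \<alpha>)) \<longlonglongrightarrow> l"
proof (rule LIMSEQ_I)
  fix \<epsilon> :: real assume \<epsilon>: "\<epsilon> > 0"
  define x where "x = real b * \<alpha>"
  have x: "x \<ge> 0" using b \<alpha> by (simp add: x_def)
  have "\<exists>\<delta>>0. \<exists>M. \<forall>m\<ge>M. \<forall>n. \<bar>real n / (real b * real m) - \<alpha>\<bar> < \<delta> \<longrightarrow> norm (f m n - l) < \<epsilon> / 2"
    by (rule sequential_limit_uniform[OF lim]) (use \<epsilon> in simp_all)
  then obtain \<delta> M where \<delta>: "\<delta> > 0"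
    and M: "\<And>m n. m \<ge> M \<Longrightarrow> \<bar>real n / (real b * real m) - \<alpha>\<bar> < \<delta> \<Longrightarrow> norm (f m n - l) < \<epsilon> / 2"
    by blast
  \<comment> \<open>The 2 is the trivial bound on the norm of \<open>f m n - l\<close>; the
    denominator is the square of the least deviation from m x of an n whose ratio misses \<alpha> by
    \<delta> or more.\<close>
  define K where "K m = 2 / (\<delta> * real b * real m)\<^sup>2" for m
  have diff: "norm (f m n - l) \<le> \<epsilon> / 2 + K m * (real n - real m * x)\<^sup>2" if m: "m \<ge> M" "m \<ge> 1" for m n
  proof (cases "\<bar>real n / (real b * real m) - \<alpha>\<bar> < \<delta>")
    case True
    then show ?thesis using M[OF m(1) True] by (intro add_increasing2) (auto simp: K_def)
  next
    case False
    have pos: "\<delta> * real b * real m > 0" using \<delta> b m by simp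
    have "real n / (real b * real m) - \<alpha> = (real n - real m * x) / (real b * real m)"
      using b m by (simp add: x_def field_simps)
    then have "\<delta> * (real b * real m) \<le> \<bar>real n - real m * x\<bar>"
      using False b m by (simp add: not_less le_divide_eq abs_mult)
    then have "(\<delta> * real b * real m)\<^sup>2 \<le> \<bar>real n - real m * x\<bar>\<^sup>2"
      using pos by (intro power_mono) (auto simp: mult.assoc)
    then have "1 \<le> (real n - real m * x)\<^sup>2 / (\<delta> * real b * real m)\<^sup>2"
      using zero_less_power[OF pos, of 2] by (simp only: le_divide_eq_1_pos power2_abs)
    then have "2 \<le> K m * (real n - real m * x)\<^sup>2" by (simp add: K_def)
    moreover have "norm (f m n - l) \<le> 1 + 1" using norm_triangle_ineq4[of "f m n" l] f[of m n] l by linarith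
    ultimately show ?thesis using \<epsilon> by linarith
  qed
  have bound: "norm (poisson_transform m (f m) x - l) \<le> \<epsilon> / 2 + K m * (real m * x)" if m: "m \<ge> M" "m \<ge> 1" for m
  proof -
    define w where "w n = (real m * x) ^ n / fact n" for n
    have w: "w n \<ge> 0" for n using x by (simp add: w_def)
    have ws: "w sums exp (real m * x)" unfolding w_def by (rule sums_poisson_mass)
    have summ: "summable (\<lambda>n. of_real (w n) * f m n)"
    proof (rule summable_comparison_test'[OF sums_summable[OF ws]])
      show "norm (of_real (w n) * f m n) \<le> w n" for n
        using w f[of m n] by (simp add: norm_mult mult_left_le)
    qed
    have "(\<lambda>n. of_real (w n) * l) sums (of_real (exp (real m * x)) * l)"
      by (intro sums_mult2 sums_of_real ws)
    with summable_sums[OF summ] have d: "(\<lambda>n. of_real (w n) * (f m n - l)) sums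
        ((\<Sum>n. of_real (w n) * f m n) - of_real (exp (real m * x)) * l)"
      unfolding right_diff_distrib by (rule sums_diff)
    have e: "(\<lambda>n. w n * (\<epsilon> / 2) + K m * (w n * (real n - real m * x)\<^sup>2)) sums
        (exp (real m * x) * (\<epsilon> / 2) + K m * (real m * x * exp (real m * x)))"
      unfolding w_def by (intro sums_add sums_mult sums_mult2 sums_poisson_mass sums_poisson_variance)
    have "norm ((\<Sum>n. of_real (w n) * f m n) - of_real (exp (real m * x)) * l)
        \<le> exp (real m * x) * (\<epsilon> / 2) + K m * (real m * x * exp (real m * x))"
      unfolding sums_unique[OF d] sums_unique[OF e]
    proof (rule norm_suminf_le[OF _ sums_summable[OF e]])
      fix n
      have "norm (of_real (w n) * (f m n - l)) = w n * norm (f m n - l)"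
        using w by (simp add: norm_mult)
      also have "\<dots> \<le> w n * (\<epsilon> / 2 + K m * (real n - real m * x)\<^sup>2)"
        by (intro mult_left_mono diff m w)
      finally show "norm (of_real (w n) * (f m n - l)) \<le> w n * (\<epsilon> / 2) + K m * (w n * (real n - real m * x)\<^sup>2)"
        by (simp add: algebra_simps)
    qed
    then have "exp (- (real m * x)) * norm ((\<Sum>n. of_real (w n) * f m n) - of_real (exp (real m * x)) * l)
        \<le> exp (- (real m * x)) * (exp (real m * x) * (\<epsilon> / 2) + K m * (real m * x * exp (real m * x)))"
      by (intro mult_left_mono) auto
    also have "\<dots> = (exp (- (real m * x)) * exp (real m * x)) * (\<epsilon> / 2 + K m * (real m * x))"
      by (simp only: algebra_simps)
    also have "exp (- (real m * x)) * exp (real m * x) = 1" by (simp flip: exp_add)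
    finally have le: "exp (- (real m * x)) * norm ((\<Sum>n. of_real (w n) * f m n) - of_real (exp (real m * x)) * l)
        \<le> \<epsilon> / 2 + K m * (real m * x)" by simp
    have "of_real (exp (- (real m * x))) * (of_real (exp (real m * x)) * l) = l"
      by (simp flip: exp_add of_real_mult mult.assoc)
    then have "poisson_transform m (f m) x - l =
        of_real (exp (- (real m * x))) * ((\<Sum>n. of_real (w n) * f m n) - of_real (exp (real m * x)) * l)"
      unfolding poisson_transform_def w_def right_diff_distrib by simp
    then show ?thesis using le by (simp only: norm_mult norm_of_real abs_exp_cancel)
  qed
  have "(\<lambda>m. \<epsilon> / 2 + K m * (real m * x)) \<longlonglongrightarrow> \<epsilon> / 2 + 0"
  proof (intro tendsto_add tendsto_const)
    have "(\<lambda>m. 2 * x / (\<delta> * real b)\<^sup>2 * (1 / real m)) \<longlonglongrightarrow> 2 * x / (\<delta> * real b)\<^sup>2 * 0"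
      by (intro tendsto_mult tendsto_const lim_1_over_n)
    moreover have "K m * (real m * x) = 2 * x / (\<delta> * real b)\<^sup>2 * (1 / real m)" for m
      by (simp add: K_def power2_eq_square)
    ultimately show "(\<lambda>m. K m * (real m * x)) \<longlonglongrightarrow> 0" by simp
  qed
  then have "\<forall>\<^sub>F m in sequentially. \<epsilon> / 2 + K m * (real m * x) < \<epsilon>"
    by (rule order_tendstoD(2)) (use \<epsilon> in simp)
  then have "\<forall>\<^sub>F m in sequentially. norm (poisson_transform m (f m) x - l) < \<epsilon>"
    using eventually_ge_at_top[of "max M 1"]
  proof eventually_elim
    case (elim m)
    then show ?case using bound[of m] by simp
  qed
  then show "\<exists>m0. \<forall>m\<ge>m0. norm (poisson_transform m (f m) (real b * \<alpha>) - l) < \<epsilon>"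
    unfolding eventually_sequentially x_def .
qed

section \<open>Abel means and the residue\<close>

text \<open>The weights (1 - x) x^(m+1) have total mass x and leave every fixed index as x tends to
  1: the first M terms contribute at most (1 - x) M C, and the later coefficients are within
  \<epsilon> / 2 of the limit.\<close>

lemma abel_mean_tendsto:
  fixes a :: "nat \<Rightarrow> complex"
  assumes a: "a \<longlonglongrightarrow> l"
  shows "((\<lambda>x::real. (1 - of_real x) * (\<Sum>m. of_real x ^ Suc m * a m)) \<longlongrightarrow> l) (at_left 1)"
proof -
  have "Bseq (\<lambda>m. a m - l)"
    by (rule convergent_imp_Bseq[OF convergentI[OF tendsto_diff[OF a tendsto_const]]])
  then obtain C where C: "C > 0" "\<And>m. norm (a m - l) \<le> C" by (auto elim: BseqE)
  \<comment> \<open>The series starts at exponent 1, so the constant sequence l has mean x l rather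
    than l; this is what gets subtracted.\<close>
  have "((\<lambda>x::real. (1 - of_real x) * (\<Sum>m. of_real x ^ Suc m * a m) - of_real x * l) \<longlongrightarrow> 0) (at_left 1)"
  proof (rule tendstoI)
    fix \<epsilon> :: real assume \<epsilon>: "\<epsilon> > 0"
    obtain M where M: "\<And>m. m \<ge> M \<Longrightarrow> norm (a m - l) < \<epsilon> / 2"
      using LIMSEQ_D[OF a, of "\<epsilon> / 2"] \<epsilon> by auto
    have bound: "norm ((1 - of_real x) * (\<Sum>m. of_real x ^ Suc m * a m) - of_real x * l) \<le> \<epsilon> / 2 + (1 - x) * (real M * C)"
      if x: "0 < x" "x < 1" for x :: real
    proof -
      have geo: "(\<lambda>m. x ^ m) sums (1 / (1 - x))" using geometric_sums[of x] x by simp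
      have geo': "(\<lambda>m. of_real x ^ Suc m * l) sums (of_real x * (1 / (1 - of_real x)) * l)"
        using sums_mult2[OF sums_mult[OF geometric_sums[of "of_real x :: complex"], of "of_real x"], of l] x by simp
      have e: "(\<lambda>m. \<epsilon> / 2 * x ^ m + (if m \<in> {..<M} then C else 0)) sums (\<epsilon> / 2 * (1 / (1 - x)) + (\<Sum>m<M. C))"
        by (intro sums_add sums_mult geo sums_If_finite_set) simp
      have term_le: "norm (of_real x ^ Suc m * (a m - l)) \<le> \<epsilon> / 2 * x ^ m + (if m \<in> {..<M} then C else 0)" for m
      proof -
        have "norm (of_real x ^ Suc m * (a m - l)) = x ^ Suc m * norm (a m - l)"
          using x by (simp add: norm_mult norm_power)
        also have "\<dots> \<le> x ^ m * norm (a m - l)"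
          using x by (intro mult_right_mono) (auto simp: mult_left_le_one_le)
        also have "\<dots> \<le> \<epsilon> / 2 * x ^ m + (if m \<in> {..<M} then C else 0)"
        proof (cases "m < M")
          case True
          have "x ^ m * norm (a m - l) \<le> 1 * C"
            using x C by (intro mult_mono) (auto simp: power_le_one)
          then show ?thesis using True \<epsilon> x by (simp add: add_increasing)
        next
          case False
          then have "x ^ m * norm (a m - l) \<le> x ^ m * (\<epsilon> / 2)"
            using x M[of m] by (intro mult_left_mono) auto
          then show ?thesis using False by (simp add: mult.commute)
        qed
        finally show ?thesis .
      qed
      have sd: "summable (\<lambda>m. of_real x ^ Suc m * (a m - l))"
        by (rule summable_comparison_test'[OF sums_summable[OF e]]) (rule term_le)
      have "(\<lambda>m. of_real x ^ Suc m * (a m - l) + of_real x ^ Suc m * l) sums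
          ((\<Sum>m. of_real x ^ Suc m * (a m - l)) + of_real x * (1 / (1 - of_real x)) * l)"
        by (intro sums_add summable_sums sd geo')
      then have "(\<Sum>m. of_real x ^ Suc m * a m) =
          (\<Sum>m. of_real x ^ Suc m * (a m - l)) + of_real x * (1 / (1 - of_real x)) * l"
        by (simp add: sums_iff flip: distrib_left)
      moreover have ox: "1 - complex_of_real x = of_real (1 - x)" by simp
      then have "1 - complex_of_real x \<noteq> 0" using x by (simp only: of_real_eq_0_iff)
      ultimately have "(1 - of_real x) * (\<Sum>m. of_real x ^ Suc m * a m) - of_real x * l
          = (1 - of_real x) * (\<Sum>m. of_real x ^ Suc m * (a m - l))"
        by (simp add: field_simps)
      also have "norm \<dots> = (1 - x) * norm (\<Sum>m. of_real x ^ Suc m * (a m - l))"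
        unfolding ox norm_mult norm_of_real using x by simp
      also have "\<dots> \<le> (1 - x) * (\<epsilon> / 2 * (1 / (1 - x)) + (\<Sum>m<M. C))"
        unfolding sums_unique[OF e] using x
        by (intro mult_left_mono norm_suminf_le term_le sums_summable[OF e]) auto
      also have "\<dots> = \<epsilon> / 2 + (1 - x) * (real M * C)" using x by (simp add: field_simps)
      finally show ?thesis .
    qed
    have "((\<lambda>x::real. \<epsilon> / 2 + (1 - x) * (real M * C)) \<longlongrightarrow> \<epsilon> / 2 + (1 - 1) * (real M * C)) (at_left 1)"
      by (intro tendsto_intros)
    then have "\<forall>\<^sub>F x in at_left 1. \<epsilon> / 2 + (1 - x) * (real M * C) < \<epsilon>"
      by (rule order_tendstoD(2)) (use \<epsilon> in simp)
    moreover have "\<forall>\<^sub>F x :: real in at_left 1. x \<in> {0<..<1}" by (rule eventually_at_leftI[of 0]) auto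
    ultimately show "\<forall>\<^sub>F x :: real in at_left 1. dist ((1 - of_real x) * (\<Sum>m. of_real x ^ Suc m * a m) - of_real x * l) 0 < \<epsilon>"
    proof eventually_elim
      case (elim x)
      then show ?case using bound[of x] by simp
    qed
  qed
  moreover have "((\<lambda>x::real. of_real x * l) \<longlongrightarrow> of_real 1 * l) (at_left 1)"
    by (intro tendsto_intros)
  ultimately have "((\<lambda>x::real. ((1 - of_real x) * (\<Sum>m. of_real x ^ Suc m * a m) - of_real x * l) + of_real x * l) \<longlongrightarrow> 0 + of_real 1 * l) (at_left 1)"
    by (rule tendsto_add)
  then show ?thesis by simp
qed

text \<open>At a simple pole the residue is the limit of (y - 1) G(y) along any filter that tends to
  1. Approaching along the reals from inside the disc makes the power series available; the sign
  comes from y - 1 against 1 - y.\<close>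

lemma residue_power_series_simple_pole:
  fixes a :: "nat \<Rightarrow> complex"
  assumes a: "a \<longlonglongrightarrow> l" and G: "\<And>y. norm y < 1 \<Longrightarrow> G y = (\<Sum>m. y ^ Suc m * a m)"
    and r: "r > 1" and an: "G analytic_on (ball 0 r - {1})" and pole: "is_pole G 1" "zorder G 1 = -1"
  shows "residue G 1 = - l"
proof (rule residue_simple_pole_limit[OF _ pole])
  \<comment> \<open>The disc around 1 that touches the boundary of the large disc witnesses that the
    singularity is isolated.\<close>
  have "ball 1 (r - 1) \<subseteq> ball (0 :: complex) r"
  proof
    fix y :: complex assume "y \<in> ball 1 (r - 1)"
    then have "norm (y - 1) < r - 1" by (simp add: dist_norm norm_minus_commute)
    then show "y \<in> ball 0 r" using norm_triangle_ineq[of "y - 1" 1] by simp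
  qed
  then have "G analytic_on (ball 1 (r - 1) - {1})"
    by (intro analytic_on_subset[OF an]) auto
  then show "isolated_singularity_at G 1"
    unfolding isolated_singularity_at_def using r by (intro exI[of _ "r - 1"]) auto
  have "\<forall>\<^sub>F x in at_left (1::real). - ((1 - of_real x) * (\<Sum>m. of_real x ^ Suc m * a m))
      = G (complex_of_real x) * (complex_of_real x - 1)"
  proof (rule eventually_at_leftI[of 0])
    fix x :: real assume "x \<in> {0<..<1}"
    then show "- ((1 - of_real x) * (\<Sum>m. of_real x ^ Suc m * a m)) = G (complex_of_real x) * (complex_of_real x - 1)"
      by (subst G) (auto simp: algebra_simps)
  qed simp
  with tendsto_minus[OF abel_mean_tendsto[OF a]]
  show "((\<lambda>x. G (complex_of_real x) * (complex_of_real x - 1)) \<longlongrightarrow> - l) (at_left 1)"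
    by (rule Lim_transform_eventually)
  show "filterlim complex_of_real (at 1) (at_left 1)"
    unfolding filterlim_at
  proof
    show "\<forall>\<^sub>F x in at_left 1. complex_of_real x \<in> UNIV \<and> complex_of_real x \<noteq> 1"
      by (rule eventually_at_leftI[of 0]) auto
    have "(complex_of_real \<longlongrightarrow> complex_of_real 1) (at_left 1)" by (intro tendsto_intros)
    then show "(complex_of_real \<longlongrightarrow> 1) (at_left 1)" by simp
  qed
  show "at_left (1::real) \<noteq> bot" by simp
qed

theorem theorem7p4:
  fixes b :: nat and \<alpha> :: real
    and P :: "hash_table \<Rightarrow> nat pmf"
    and conv :: "nat \<Rightarrow> nat \<Rightarrow> nat pmf"
  assumes "b \<ge> 1" and "0 \<le> \<alpha>" and "\<alpha> < 1"
    and "determined_by_profile b P"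
    and "AE X in poisson_model b \<alpha>. \<exists>N. determined_by_window b P (profile b (Infinite X)) N"
  shows
    "(\<forall>m n :: nat \<Rightarrow> nat.
        filterlim m at_top sequentially \<longrightarrow> filterlim n at_top sequentially \<longrightarrow>
        (\<lambda>k. real (n k) / (real b * real (m k))) \<longlonglongrightarrow> \<alpha> \<longrightarrow>
        converges_in_distribution (\<lambda>k. exact_law b conv P (m k) (n k)) (poisson_model_law b P \<alpha>) \<and>
        (\<forall>q. norm q \<le> 1 \<longrightarrow>
          (\<lambda>k. pgf (exact_law b conv P (m k) (n k)) q) \<longlonglongrightarrow> pgf (poisson_model_law b P \<alpha>) q))
     \<and>
     (\<forall>q. norm q \<le> 1 \<longrightarrow>
        (\<lambda>m. poisson_transform m (\<lambda>n. pgf (exact_law b conv P m n) q) (real b * \<alpha>))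
          \<longlonglongrightarrow> pgf (poisson_model_law b P \<alpha>) q)
     \<and>
     (\<forall>q r G. norm q \<le> 1 \<longrightarrow> r > 1 \<longrightarrow>
        (\<forall>y. norm y < 1 \<longrightarrow>
          G y = (\<Sum>m. y ^ Suc m *
            poisson_transform (Suc m) (\<lambda>n. pgf (exact_law b conv P (Suc m) n) q) (real b * \<alpha>))) \<longrightarrow>
        G analytic_on (ball 0 r - {1}) \<longrightarrow> is_pole G 1 \<longrightarrow> zorder G 1 = -1 \<longrightarrow>
        residue G 1 = - pgf (poisson_model_law b P \<alpha>) q)"
proof -
  define p where "p m n = (if n < b * m then bind_pmf (exact_table m n) P else conv m n)" for m n
  define p0 where "p0 = poisson_property_pmf b P \<alpha>"
  have exact: "exact_law b conv P m n = measure_pmf (p m n)" for m n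
    by (simp add: exact_law_def p_def)
  have poisson: "poisson_model_law b P \<alpha> = measure_pmf p0"
    unfolding p0_def by (rule poisson_model_law_eq) fact+
  have lim: "(\<lambda>k. pmf (p (m k) (n k)) x) \<longlonglongrightarrow> pmf p0 x"
    if m: "filterlim m at_top sequentially" and n: "(\<lambda>k. real (n k) / (real b * real (m k))) \<longlonglongrightarrow> \<alpha>"
    for m n :: "nat \<Rightarrow> nat" and x
  proof -
    \<comment> \<open>As \<alpha> < 1, eventually n < b m, so the convention for undefined tables
      does not affect the limit.\<close>
    have "\<forall>\<^sub>F k in sequentially. real (n k) / (real b * real (m k)) < 1"
      using order_tendstoD(2)[OF n] assms by blast
    moreover have "\<forall>\<^sub>F k in sequentially. m k \<ge> 1"
      using m eventually_ge_at_top[of 1] unfolding filterlim_iff by blast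
    ultimately have "\<forall>\<^sub>F k in sequentially. pmf (bind_pmf (exact_table (m k) (n k)) P) x = pmf (p (m k) (n k)) x"
    proof eventually_elim
      case (elim k)
      then have "real (n k) < real (b * m k)" using assms by (simp add: divide_less_eq)
      then show ?case by (simp only: p_def of_nat_less_iff if_True)
    qed
    moreover have "(\<lambda>k. pmf (bind_pmf (exact_table (m k) (n k)) P) x) \<longlonglongrightarrow> pmf p0 x"
      unfolding p0_def by (rule pmf_exact_property_tendsto[OF assms(1-3,5) m n])
    ultimately show ?thesis by (rule Lim_transform_eventually[rotated])
  qed
  have transform: "(\<lambda>m. poisson_transform m (\<lambda>n. pgf (measure_pmf (p m n)) q) (real b * \<alpha>)) \<longlonglongrightarrow> pgf (measure_pmf p0) q"
    if "norm q \<le> 1" for q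
    by (rule poisson_transform_tendsto) (use assms that in \<open>auto intro: pgf_tendsto lim norm_pgf_le\<close>)
  show ?thesis
    unfolding exact poisson
    using lim transform
    \<comment> \<open>\<open>LIMSEQ_Suc\<close> because the coefficient of y^(m+1) in the series is
      the transform for m + 1 buckets.\<close>
    by (intro conjI allI impI converges_in_distribution_pmf pgf_tendsto residue_power_series_simple_pole[OF LIMSEQ_Suc[OF transform]]) auto
qed

end
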